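(* Let $F^*=\min_{x\in\operatorname{dom}\psi}[F(x):=f(x)+\psi(x)]$ be the composite convex problem described in the context. Suppose that $D>0$ satisfies $\|x-y\|\le D$ for all $x,y\in\operatorname{dom}\psi$, that the Hölder constant $L_\nu$ of $f$ is finite for at least one $\nu\in[0,1]$, and that $f$ is accessible via an unbiased stochastic gradient oracle $\hat g=(g,\xi)$ with bounded variance $\sigma^2<+\infty$ (as defined in the context). Let $(x_k)_{k\ge0}$ be generated by the Universal Stochastic Fast Gradient Method (defined in the context). Then, for all $k\ge1$, $$\mathbb{E}[F(x_k)]-F^*\le\inf_{\nu\in[0,1]}\frac{32L_\nu D^{1+\nu}}{k^{(1+3\nu)/2}}+\frac{8\sigma D}{\sqrt{3k}}.$$ Consequently, for any $\epsilon>0$, to reach $\mathbb{E}[F(x_k)]-F^*\le\epsilon$ it suffices to make $$O\Bigl(\inf_{\nu\in[0,1]}\Bigl[\frac{L_\nu D^{1+\nu}}{\epsilon}\Bigr]^{2/(1+3\nu)}+\frac{\sigma^2D^2}{\epsilon^2}\Bigr)$$ oracle calls, where $O(\cdot)$ hides an absolute constant.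
   Context: Norms: $\mathbb{R}^n$ carries the standard inner product $\langle\cdot,\cdot\rangle$, the norm $\|x\|=\langle Bx,x\rangle^{1/2}$ for a fixed symmetric positive definite matrix $B$, and the dual norm $\|s\|_*=\langle s,B^{-1}s\rangle^{1/2}$. Problem: $\psi:\mathbb{R}^n\to\mathbb{R}\cup\{+\infty\}$ is a proper closed convex function; $f:\mathbb{R}^n\to\mathbb{R}\cup\{+\infty\}$ is a closed convex function which is finite and subdifferentiable over an open set containing $\operatorname{dom}\psi=\{x:\psi(x)<+\infty\}$. Hölder constants: for $\nu\in[0,1]$, $$L_\nu:=\sup\Bigl\{\frac{\|g(x)-g(y)\|_*}{\|x-y\|^\nu}: x,y\in\operatorname{dom}\psi,\ x\ne y,\ g(x)\in\partial f(x),\ g(y)\in\partial f(y)\Bigr\}\in[0,+\infty].$$ Terms with $L_\nu=+\infty$ are interpreted as $+\infty$ in the infima. Stochastic gradient oracle: a pair $\hat g=(g,\xi)$ of a random variable $\xi$ and a mapping $g:\operatorname{dom}f\times\operatorname{Im}\xi\to\mathbb{R}^n$. Each time it is queried at a point $x\in\operatorname{dom}\psi$, it generates a fresh copy of $\xi$, independent of everything generated before, and returns $g(x,\xi)$ (written $s\sim\hat g(x)$). Unbiasedness with bounded variance means: for every $x\in\operatorname{dom}\psi$, $f'(x):=\mathbb{E}_\xi[g(x,\xi)]\in\partial f(x)$, and $\sigma^2:=\sup_{x\in\operatorname{dom}\psi}\mathbb{E}_\xi[\|g(x,\xi)-f'(x)\|_*^2]<+\infty$. Notation: $[t]_+=\max\{t,0\}$;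 $\mathbb{E}$ is the full expectation. Universal Stochastic Fast Gradient Method: choose $x_0=v_0\in\operatorname{dom}\psi$, set $H_0:=A_0:=0$. For $k=0,1,\ldots$: 1. $a_{k+1}:=k+1$, $A_{k+1}:=A_k+a_{k+1}$; 2. $y_k:=\frac{A_k}{A_{k+1}}x_k+\frac{a_{k+1}}{A_{k+1}}v_k$, and sample $g_k^y\sim\hat g(y_k)$; 3. let $v_{k+1}$ be a solution (an arbitrary one if it is not unique) of $\min_{x\in\operatorname{dom}\psi}\{a_{k+1}[\langle g_k^y,x\rangle+\psi(x)]+\frac{H_k}{2}\|x-v_k\|^2\}$; 4. $x_{k+1}:=\frac{A_k}{A_{k+1}}x_k+\frac{a_{k+1}}{A_{k+1}}v_{k+1}$; 5. sample $g_{k+1}^x\sim\hat g(x_{k+1})$ and set $$H_{k+1}:=H_k+\frac{[A_{k+1}\hat\beta_{k+1}-\frac12H_kr_{k+1}^2]_+}{D^2+\frac12r_{k+1}^2},$$ where $r_{k+1}:=\|v_{k+1}-v_k\|$ and $\hat\beta_{k+1}:=\langle g_{k+1}^x-g_k^y,x_{k+1}-y_k\rangle$. *)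

theory Defs
  imports "HOL-Probability.Probability"
begin

definition sym_posdef :: "real^'n^'n \<Rightarrow> bool" where
  "sym_posdef B \<longleftrightarrow> transpose B = B \<and> (\<forall>x. x \<noteq> 0 \<longrightarrow> 0 < (B *v x) \<bullet> x)"

definition norm_of :: "real^'n^'n \<Rightarrow> real^'n \<Rightarrow> real" where
  "norm_of B x = sqrt ((B *v x) \<bullet> x)"

definition dual_norm_of :: "real^'n^'n \<Rightarrow> real^'n \<Rightarrow> real" where
  "dual_norm_of B s = sqrt (s \<bullet> (matrix_inv B *v s))"

definition eff_dom :: "('a \<Rightarrow> ereal) \<Rightarrow> 'a set" where
  "eff_dom \<phi> = {x. \<phi> x < \<infinity>}"

definition ereal_epigraph :: "('a \<Rightarrow> ereal) \<Rightarrow> ('a \<times> real) set" where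
  "ereal_epigraph \<phi> = {(x, t). \<phi> x \<le> ereal t}"

text \<open>Functions with values in the reals extended by plus infinity only; both convexity and
  closedness are properties of the epigraph.\<close>

definition closed_convex_fun :: "('a::euclidean_space \<Rightarrow> ereal) \<Rightarrow> bool" where
  "closed_convex_fun \<phi> \<longleftrightarrow>
     (\<forall>x. \<phi> x \<noteq> -\<infinity>) \<and> convex (ereal_epigraph \<phi>) \<and> closed (ereal_epigraph \<phi>)"

definition subdifferential :: "('a::euclidean_space \<Rightarrow> ereal) \<Rightarrow> 'a \<Rightarrow> 'a set" where
  "subdifferential \<phi> x =
     {s. \<bar>\<phi> x\<bar> \<noteq> \<infinity> \<and> (\<forall>y. \<phi> x + ereal (s \<bullet> (y - x)) \<le> \<phi> y)}"

text \<open>The supremum is taken in the extended nonnegative reals, so it is 0 when \<open>eff_dom \<psi>\<close> is a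
  singleton.\<close>

definition hoelder_const ::
    "real^'n^'n \<Rightarrow> (real^'n \<Rightarrow> ereal) \<Rightarrow> (real^'n \<Rightarrow> ereal) \<Rightarrow> real \<Rightarrow> ennreal" where
  "hoelder_const B \<psi> f \<nu> =
     Sup {ennreal (dual_norm_of B (s - t) / norm_of B (x - y) powr \<nu>) | x y s t.
            x \<in> eff_dom \<psi> \<and> y \<in> eff_dom \<psi> \<and> x \<noteq> y \<and>
            s \<in> subdifferential f x \<and> t \<in> subdifferential f y}"

text \<open>Real powers on the extended nonnegative reals, meant for exponents \<open>p > 0\<close>.\<close>

definition ennreal_powr :: "ennreal \<Rightarrow> real \<Rightarrow> ennreal" where
  "ennreal_powr c p = (if c = \<infinity> then \<infinity> else ennreal (enn2real c powr p))"

text \<open>The random variable of the oracle enters through its law \<open>P\<close>, a probability measure on its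
  range; \<open>g x e\<close> is the answer at the point \<open>x\<close> for the realisation \<open>e\<close>. Joint measurability is what
  makes the answer at a random query point a random vector.\<close>

definition unbiased_oracle ::
    "(real^'n \<Rightarrow> ereal) \<Rightarrow> (real^'n \<Rightarrow> ereal) \<Rightarrow> 'e measure \<Rightarrow> (real^'n \<Rightarrow> 'e \<Rightarrow> real^'n) \<Rightarrow> bool" where
  "unbiased_oracle \<psi> f P g \<longleftrightarrow>
     prob_space P \<and>
     (\<lambda>(x, e). g x e) \<in> borel_measurable (restrict_space borel (eff_dom \<psi>) \<Otimes>\<^sub>M P) \<and>
     (\<forall>x\<in>eff_dom \<psi>. integrable P (g x) \<and> (\<integral>e. g x e \<partial>P) \<in> subdifferential f x)"

definition oracle_variance ::
    "real^'n^'n \<Rightarrow> (real^'n \<Rightarrow> ereal) \<Rightarrow> 'e measure \<Rightarrow> (real^'n \<Rightarrow> 'e \<Rightarrow> real^'n) \<Rightarrow> ennreal" where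
  "oracle_variance B \<psi> P g =
     (SUP x\<in>eff_dom \<psi>. \<integral>\<^sup>+e. ennreal ((dual_norm_of B (g x e - (\<integral>e'. g x e' \<partial>P)))\<^sup>2) \<partial>P)"

text \<open>\<open>\<xi>y k\<close> drives the query at \<open>y\<^sub>k\<close> and \<open>\<xi>x k\<close> (\<open>k \<ge> 1\<close>) the query at \<open>x\<^sub>k\<close>. All quantities
  computed by the method are functions of the samples and of the points \<open>v\<^sub>k\<close>. The latter belong to
  the history because the choice among several solutions of the subproblem is arbitrary (possibly
  randomised); they must not depend on samples that are still to be drawn.\<close>

definition history ::
    "(nat \<Rightarrow> 'w \<Rightarrow> 'v) \<Rightarrow> (nat \<Rightarrow> 'w \<Rightarrow> 'e) \<Rightarrow> (nat \<Rightarrow> 'w \<Rightarrow> 'e) \<Rightarrow> nat \<Rightarrow> nat \<Rightarrow> nat \<Rightarrow>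
     'w \<Rightarrow> (nat \<Rightarrow> 'v) \<times> (nat \<Rightarrow> 'e) \<times> (nat \<Rightarrow> 'e)" where
  "history v \<xi>y \<xi>x m p q =
     (\<lambda>\<omega>. (\<lambda>i\<in>{..m}. v i \<omega>, \<lambda>i\<in>{..<p}. \<xi>y i \<omega>, \<lambda>i\<in>{1..q}. \<xi>x i \<omega>))"

definition history_space ::
    "'e measure \<Rightarrow> nat \<Rightarrow> nat \<Rightarrow> nat \<Rightarrow>
     ((nat \<Rightarrow> 'v::topological_space) \<times> (nat \<Rightarrow> 'e) \<times> (nat \<Rightarrow> 'e)) measure" where
  "history_space P m p q =
     (\<Pi>\<^sub>M i\<in>{..m}. borel) \<Otimes>\<^sub>M (\<Pi>\<^sub>M i\<in>{..<p}. P) \<Otimes>\<^sub>M (\<Pi>\<^sub>M i\<in>{1..q}. P)"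

text \<open>This is \<open>prob_space.indep_var\<close>, which is restricted to two random variables with values in
  the same type, for values in different types (cf. \<open>indep_var_eq\<close>).\<close>

definition indep_rv ::
    "'w measure \<Rightarrow> 'a measure \<Rightarrow> ('w \<Rightarrow> 'a) \<Rightarrow> 'b measure \<Rightarrow> ('w \<Rightarrow> 'b) \<Rightarrow> bool" where
  "indep_rv M S X T Y \<longleftrightarrow>
     X \<in> measurable M S \<and> Y \<in> measurable M T \<and>
     prob_space.indep_set M {X -` A \<inter> space M | A. A \<in> sets S} {Y -` A \<inter> space M | A. A \<in> sets T}"

definition fresh_copies ::
    "'w measure \<Rightarrow> 'e measure \<Rightarrow> (nat \<Rightarrow> 'w \<Rightarrow> 'v::topological_space) \<Rightarrow>
     (nat \<Rightarrow> 'w \<Rightarrow> 'e) \<Rightarrow> (nat \<Rightarrow> 'w \<Rightarrow> 'e) \<Rightarrow> bool" where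
  "fresh_copies M P v \<xi>y \<xi>x \<longleftrightarrow>
     (\<forall>k. distr M P (\<xi>y k) = P \<and>
          indep_rv M (history_space P k k k) (history v \<xi>y \<xi>x k k k) P (\<xi>y k) \<and>
          distr M P (\<xi>x (Suc k)) = P \<and>
          indep_rv M (history_space P (Suc k) (Suc k) k)
            (history v \<xi>y \<xi>x (Suc k) (Suc k) k) P (\<xi>x (Suc k)))"

text \<open>The weights satisfy \<open>a\<^sub>k\<^sub>+\<^sub>1 = k + 1\<close>; the value at 0 is not used.\<close>

definition weight :: "nat \<Rightarrow> real" where
  "weight k = real k"

primrec cum_weight :: "nat \<Rightarrow> real" where
  "cum_weight 0 = 0"
| "cum_weight (Suc k) = cum_weight k + weight (Suc k)"

text \<open>One run of the Universal Stochastic Fast Gradient Method, where \<open>gy k\<close> and \<open>gx k\<close> are the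
  oracle answers at \<open>y k\<close> and \<open>x k\<close>; \<open>gx 0\<close> is not used.\<close>

definition usfgm_run ::
    "real^'n^'n \<Rightarrow> (real^'n \<Rightarrow> ereal) \<Rightarrow> real \<Rightarrow> real^'n \<Rightarrow>
     (nat \<Rightarrow> real^'n) \<Rightarrow> (nat \<Rightarrow> real^'n) \<Rightarrow>
     (nat \<Rightarrow> real^'n) \<Rightarrow> (nat \<Rightarrow> real^'n) \<Rightarrow> (nat \<Rightarrow> real^'n) \<Rightarrow> (nat \<Rightarrow> real) \<Rightarrow> bool" where
  "usfgm_run B \<psi> D x0 gy gx x v y H \<longleftrightarrow>
     x0 \<in> eff_dom \<psi> \<and> x 0 = x0 \<and> v 0 = x0 \<and> H 0 = 0 \<and>
     (\<forall>k. let a = weight (Suc k); A = cum_weight k; A' = cum_weight (Suc k);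
              r = norm_of B (v (Suc k) - v k);
              \<beta> = (gx (Suc k) - gy k) \<bullet> (x (Suc k) - y k)
          in y k = (A / A') *\<^sub>R x k + (a / A') *\<^sub>R v k \<and>
             is_arg_min
               (\<lambda>z. ereal a * (ereal (gy k \<bullet> z) + \<psi> z) + ereal (H k / 2 * (norm_of B (z - v k))\<^sup>2))
               (\<lambda>z. z \<in> eff_dom \<psi>) (v (Suc k)) \<and>
             x (Suc k) = (A / A') *\<^sub>R x k + (a / A') *\<^sub>R v (Suc k) \<and>
             H (Suc k) = H k + max (A' * \<beta> - H k * r\<^sup>2 / 2) 0 / (D\<^sup>2 + r\<^sup>2 / 2))"

text \<open>Each of the first \<open>k\<close> iterations queries the oracle twice.\<close>

definition usfgm_oracle_calls :: "nat \<Rightarrow> nat" where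
  "usfgm_oracle_calls k = 2 * k"

end

theory Submission
  imports Defs
begin

text \<open>
  Weighing optimality of the proximal step against subgradient inequalities at \<open>y\<^sub>k\<close> and
  \<open>x\<^sub>k\<^sub>+\<^sub>1\<close> gives, along every trajectory and for every feasible \<open>z\<close>,
  \<open>A\<^sub>k (F x\<^sub>k - F z) \<le> 2 D\<^sup>2 H\<^sub>k\<close> plus a sum of terms linear in the oracle errors, which have
  expectation zero because the samples are fresh. It remains to bound \<open>H\<^sub>k\<close>. The update rule is
  equivalent to the implicit equation
  \<open>D\<^sup>2 (H\<^sub>k\<^sub>+\<^sub>1 - H\<^sub>k) = [A\<^sub>k\<^sub>+\<^sub>1 \<beta>\<^sub>k\<^sub>+\<^sub>1 - H\<^sub>k\<^sub>+\<^sub>1 r\<^sup>2 / 2]\<^sub>+\<close>. Splitting the quadratic term evenly between the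
  Hoelder part and the noise part of \<open>\<beta>\<close> shows by induction that, along every trajectory,
  \<open>H\<^sub>k\<close> is at most \<open>8 L\<^sub>\<nu> D\<close> to the power \<open>\<nu> - 1\<close> times \<open>k\<close> to the power \<open>3 (1 - \<nu>) / 2\<close>, plus
  \<open>sqrt (2 \<Sum>i<k. (i + 1)\<^sup>2 \<delta>\<^sub>i\<^sup>2) / D\<close>, where \<open>\<delta>\<^sub>i\<close> is the dual norm of the difference of the two
  oracle errors of step \<open>i\<close>. These two errors are orthogonal, so \<open>\<delta>\<^sub>i\<^sup>2\<close> has expectation at most
  \<open>2 \<sigma>\<^sup>2\<close>, and concavity of the square root finishes the proof.
\<close>

subsection \<open>Primal and dual norms, closed convex functions\<close>

locale spd_matrix =
  fixes B :: "real^'n^'n"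
  assumes posdef: "sym_posdef B"
begin

lemma mult_inner_commute: "(B *v x) \<bullet> y = (B *v y) \<bullet> x"
proof -
  have "transpose B = B"
    using posdef by (simp add: sym_posdef_def)
  then have "x \<bullet> (B *v y) = (B *v x) \<bullet> y"
    by (metis dot_lmul_matrix transpose_matrix_vector)
  then show ?thesis
    by (simp add: inner_commute)
qed

lemma quad_nonneg: "0 \<le> (B *v x) \<bullet> x"
proof (cases "x = 0")
  case False
  then show ?thesis
    using posdef by (simp add: sym_posdef_def less_imp_le)
qed simp

lemma norm_of_nonneg [simp]: "0 \<le> norm_of B x"
  by (simp add: norm_of_def quad_nonneg)

lemma norm_of_pos: "x \<noteq> 0 \<Longrightarrow> 0 < norm_of B x"
  using posdef by (simp add: norm_of_def sym_posdef_def)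

lemma norm_of_zero [simp]: "norm_of B 0 = 0"
  by (simp add: norm_of_def)

lemma norm_of_square: "(norm_of B x)\<^sup>2 = (B *v x) \<bullet> x"
  by (simp add: norm_of_def quad_nonneg)

lemma norm_of_scale: "norm_of B (c *\<^sub>R x) = \<bar>c\<bar> * norm_of B x"
  by (simp add: norm_of_def matrix_vector_mult_scaleR real_sqrt_mult)

lemma norm_of_add_square:
  "(norm_of B (x + y))\<^sup>2 = (norm_of B x)\<^sup>2 + 2 * ((B *v x) \<bullet> y) + (norm_of B y)\<^sup>2"
  unfolding norm_of_square
  by (simp add: matrix_vector_right_distrib inner_add_left inner_add_right mult_inner_commute[of y x])

text \<open>Cauchy-Schwarz for the inner product induced by \<open>B\<close>, from expanding the
  nonnegative square of q x - p y, the combination that vanishes when x and y point in the same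
  direction.\<close>

lemma inner_mult_le: "(B *v x) \<bullet> y \<le> norm_of B x * norm_of B y"
proof (cases "x = 0 \<or> y = 0")
  case False
  define p q where "p = norm_of B x" and "q = norm_of B y"
  have pos: "0 < p" "0 < q"
    using False norm_of_pos by (auto simp: p_def q_def)
  have "0 \<le> (norm_of B (q *\<^sub>R x + (- p) *\<^sub>R y))\<^sup>2"
    by simp
  also have "\<dots> = 2 * (p * q) * (p * q - (B *v x) \<bullet> y)"
    by (simp only: norm_of_add_square norm_of_scale power_mult_distrib)
       (simp add: p_def [symmetric] q_def [symmetric] matrix_vector_mult_scaleR power2_eq_square algebra_simps)
  finally have "0 \<le> p * q - (B *v x) \<bullet> y"
    using pos mult_pos_pos[OF pos] by (auto simp: zero_le_mult_iff)
  then show ?thesis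
    by (simp add: p_def q_def)
qed auto

text \<open>Positive definiteness makes the kernel of \<open>B\<close> trivial, so \<open>B\<close>
  is invertible and \<open>matrix_inv B\<close> is a genuine right inverse.\<close>

lemma mult_matrix_inv: "B *v (matrix_inv B *v s) = s"
proof -
  have "inj ((*v) B)"
  proof (rule injI)
    fix x y assume "B *v x = B *v y"
    then have "(B *v (x - y)) \<bullet> (x - y) = 0"
      by (simp add: matrix_vector_mult_diff_distrib)
    then show "x = y"
      using posdef unfolding sym_posdef_def by (metis less_irrefl right_minus_eq)
  qed
  then have "invertible B"
    using invertible_left_inverse matrix_left_invertible_injective by blast
  then have "B ** matrix_inv B = mat 1"
    unfolding matrix_inv_def invertible_def by (rule someI2_ex) simp
  then show ?thesis
    by (simp add: matrix_vector_mul_assoc)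
qed

text \<open>The dual norm of s is the primal norm of its Riesz representer, so facts about the dual
  norm reduce to facts about \<open>norm_of B\<close>.\<close>

lemma dual_norm_of_eq: "dual_norm_of B s = norm_of B (matrix_inv B *v s)"
  by (simp add: dual_norm_of_def norm_of_def mult_matrix_inv)

lemma dual_norm_of_nonneg [simp]: "0 \<le> dual_norm_of B s"
  by (simp add: dual_norm_of_eq)

lemma inner_le_dual_norm: "s \<bullet> x \<le> dual_norm_of B s * norm_of B x"
  using inner_mult_le[of "matrix_inv B *v s" x] by (simp add: mult_matrix_inv dual_norm_of_eq)

lemma dual_norm_of_square: "(dual_norm_of B s)\<^sup>2 = s \<bullet> (matrix_inv B *v s)"
  by (simp add: dual_norm_of_eq norm_of_square mult_matrix_inv)

text \<open>Later s and t are the two oracle errors of one step. The inverse sits on t, the earlier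
  error, so that the cross term is a vector known from the past paired with the later error.\<close>

lemma dual_norm_of_diff_square:
  "(dual_norm_of B (s - t))\<^sup>2 = (dual_norm_of B s)\<^sup>2 + (dual_norm_of B t)\<^sup>2 - 2 * ((matrix_inv B *v t) \<bullet> s)"
proof -
  have "(matrix_inv B *v s) \<bullet> t = (matrix_inv B *v t) \<bullet> s"
    using mult_inner_commute[of "matrix_inv B *v s" "matrix_inv B *v t"]
    by (simp add: mult_matrix_inv inner_commute)
  then show ?thesis
    unfolding dual_norm_of_square
    by (simp add: matrix_vector_mult_diff_distrib inner_diff_left inner_diff_right inner_commute)
qed

lemma norm_of_le_norm: obtains K where "0 < K" "\<And>x. norm_of B x \<le> K * norm x"
proof -
  obtain K where K: "0 < K" "\<And>x. norm (B *v x) \<le> norm x * K"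
    using bounded_linear.pos_bounded[OF matrix_vector_mul_bounded_linear[of B]] by blast
  have "norm_of B x \<le> sqrt K * norm x" for x
  proof -
    have "(norm_of B x)\<^sup>2 \<le> norm (B *v x) * norm x"
      by (simp add: norm_of_square norm_cauchy_schwarz)
    also have "\<dots> \<le> norm x * K * norm x"
      by (rule mult_right_mono[OF K(2)]) simp
    also have "\<dots> = (sqrt K * norm x)\<^sup>2"
      using K(1) by (simp add: power2_eq_square)
    finally show ?thesis
      using K(1) power2_le_imp_le by fastforce
  qed
  with that[of "sqrt K"] K(1) show thesis
    by simp
qed

text \<open>Follows by duality from s \<bullet> s and the previous comparison. It turns the variance
  bound, stated in the dual norm, into square integrability in the Euclidean norm.\<close>

lemma norm_le_dual_norm_of: obtains K where "0 < K" "\<And>s. norm s \<le> K * dual_norm_of B s"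
proof -
  obtain K where K: "0 < K" "\<And>x. norm_of B x \<le> K * norm x"
    using norm_of_le_norm by blast
  have "norm s \<le> K * dual_norm_of B s" for s
  proof (cases "s = 0")
    case False
    have "norm s * norm s \<le> dual_norm_of B s * norm_of B s"
      using inner_le_dual_norm[of s s] by (simp add: dot_square_norm power2_eq_square)
    also have "\<dots> \<le> dual_norm_of B s * (K * norm s)"
      by (rule mult_left_mono[OF K(2)]) simp
    finally show ?thesis
      using False by (simp add: mult_ac)
  qed (use K in simp)
  with that K(1) show thesis
    by blast
qed

text \<open>Converts the diameter bound \<open>D\<close> into Euclidean boundedness of the domain
  and of differences of iterates.\<close>

lemma norm_le_norm_of: obtains K where "0 < K" "\<And>x. norm x \<le> K * norm_of B x"
proof -
  obtain K where K: "0 < K" "\<And>x. norm (matrix_inv B *v x) \<le> norm x * K"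
    using bounded_linear.pos_bounded[OF matrix_vector_mul_bounded_linear[of "matrix_inv B"]] by blast
  have "norm x \<le> sqrt K * norm_of B x" for x
  proof (cases "x = 0")
    case False
    have dual: "dual_norm_of B x \<le> sqrt K * norm x"
    proof -
      have "(dual_norm_of B x)\<^sup>2 \<le> norm x * norm (matrix_inv B *v x)"
        by (simp add: dual_norm_of_square norm_cauchy_schwarz)
      also have "\<dots> \<le> norm x * (norm x * K)"
        by (rule mult_left_mono[OF K(2)]) simp
      also have "\<dots> = (sqrt K * norm x)\<^sup>2"
        using K(1) by (simp add: power2_eq_square)
      finally show ?thesis
        using K(1) power2_le_imp_le by fastforce
    qed
    have "norm x * norm x \<le> dual_norm_of B x * norm_of B x"
      using inner_le_dual_norm[of x x] by (simp add: dot_square_norm power2_eq_square)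
    also have "\<dots> \<le> sqrt K * norm x * norm_of B x"
      by (rule mult_right_mono[OF dual]) simp
    finally show ?thesis
      using False by (simp add: mult_ac)
  qed simp
  with that[of "sqrt K"] K(1) show thesis
    by simp
qed

end

text \<open>Let t tend to 0 from the right. This discards the second-order term in
  \<open>prox_optimality\<close>.\<close>

lemma nonneg_of_affine_nonneg:
  fixes p q :: real
  assumes "\<And>t. 0 < t \<Longrightarrow> t \<le> 1 \<Longrightarrow> 0 \<le> p + t * q"
  shows "0 \<le> p"
proof (rule tendsto_lowerbound)
  show "((\<lambda>t. p + t * q) \<longlongrightarrow> p) (at_right 0)"
    by (auto intro!: tendsto_eq_intros)
  show "\<forall>\<^sub>F t in at_right 0. 0 \<le> p + t * q"
    unfolding eventually_at_right_field using assms by (intro exI[of _ 1]) auto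
qed simp

section \<open>Closed convex functions with values in the extended reals\<close>

lemma eff_dom_finite:
  assumes "closed_convex_fun \<phi>" "z \<in> eff_dom \<phi>"
  shows "\<phi> z = ereal (real_of_ereal (\<phi> z))"
  using assms by (auto simp: closed_convex_fun_def eff_dom_def ereal_real)

lemma closed_convex_fun_combination:
  assumes \<phi>: "closed_convex_fun \<phi>" and z: "z \<in> eff_dom \<phi>" and w: "w \<in> eff_dom \<phi>"
    and c: "0 \<le> c" "0 \<le> d" "c + d = 1"
  shows "c *\<^sub>R z + d *\<^sub>R w \<in> eff_dom \<phi>"
    and "real_of_ereal (\<phi> (c *\<^sub>R z + d *\<^sub>R w)) \<le> c * real_of_ereal (\<phi> z) + d * real_of_ereal (\<phi> w)"
proof -
  define s t where "s = real_of_ereal (\<phi> z)" and "t = real_of_ereal (\<phi> w)"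
  have "(z, s) \<in> ereal_epigraph \<phi>" "(w, t) \<in> ereal_epigraph \<phi>"
    using eff_dom_finite[OF \<phi> z] eff_dom_finite[OF \<phi> w] by (auto simp: ereal_epigraph_def s_def t_def)
  then have "c *\<^sub>R (z, s) + d *\<^sub>R (w, t) \<in> ereal_epigraph \<phi>"
    using \<phi> c unfolding closed_convex_fun_def by (intro convexD) auto
  then have *: "\<phi> (c *\<^sub>R z + d *\<^sub>R w) \<le> ereal (c * s + d * t)"
    by (simp add: ereal_epigraph_def)
  then show dom: "c *\<^sub>R z + d *\<^sub>R w \<in> eff_dom \<phi>"
    by (auto simp: eff_dom_def intro: le_less_trans)
  show "real_of_ereal (\<phi> (c *\<^sub>R z + d *\<^sub>R w)) \<le> c * real_of_ereal (\<phi> z) + d * real_of_ereal (\<phi> w)"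
    using * eff_dom_finite[OF \<phi> dom] unfolding s_def t_def by (metis ereal_less_eq(3))
qed

text \<open>A sublevel set is the preimage of the closed epigraph under the continuous map sending z
  to (z, t).\<close>

lemma closed_convex_fun_closed_sublevel:
  assumes "closed_convex_fun \<phi>"
  shows "closed {z. \<phi> z \<le> ereal t}"
proof -
  have "closed ((\<lambda>z. (z, t)) -` ereal_epigraph \<phi>)"
    using assms unfolding closed_convex_fun_def
    by (intro continuous_closed_vimage) (auto intro!: continuous_intros)
  then show ?thesis
    by (simp add: ereal_epigraph_def vimage_def)
qed

lemma closed_convex_fun_borel:
  assumes "closed_convex_fun \<phi>"
  shows "\<phi> \<in> borel_measurable borel"
proof (rule borel_measurableI_le)
  fix a
  show "{z \<in> space borel. \<phi> z \<le> a} \<in> sets borel"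
  proof (cases a)
    case (real t)
    then show ?thesis
      using closed_convex_fun_closed_sublevel[OF assms] by simp
  next
    case MInf
    then have "{z \<in> space borel. \<phi> z \<le> a} = {}"
      using assms by (auto simp: closed_convex_fun_def)
    then show ?thesis
      by simp
  qed simp
qed

text \<open>Otherwise some sequence has values below -n; a limit point of it lies in every closed
  sublevel set, so the function would be -\<infinity> there.\<close>

lemma closed_convex_fun_bounded_below:
  assumes \<phi>: "closed_convex_fun \<phi>" and bdd: "bounded (eff_dom \<phi>)"
  obtains m where "\<And>z. z \<in> eff_dom \<phi> \<Longrightarrow> m \<le> real_of_ereal (\<phi> z)"
proof -
  have "\<exists>m. \<forall>z\<in>eff_dom \<phi>. m \<le> real_of_ereal (\<phi> z)"
  proof (rule ccontr)
    assume "\<not> ?thesis"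
    then have "\<forall>n. \<exists>z\<in>eff_dom \<phi>. real_of_ereal (\<phi> z) < - real n"
      by (meson not_le)
    then obtain u where u: "\<And>n. u n \<in> eff_dom \<phi>" "\<And>n. real_of_ereal (\<phi> (u n)) < - real n"
      by metis
    then have "bounded (range u)"
      using bdd by (meson bounded_subset image_subsetI)
    then obtain l r where r: "strict_mono (r :: nat \<Rightarrow> nat)" "(u \<circ> r) \<longlonglongrightarrow> l"
      using bounded_imp_convergent_subsequence[of u] by blast
    have "\<phi> l \<le> ereal t" for t
    proof -
      have "\<forall>\<^sub>F n in sequentially. - real n \<le> t"
        using eventually_ge_at_top[of "nat \<lceil>- t\<rceil>"] by eventually_elim linarith
      then have "\<forall>\<^sub>F n in sequentially. (u \<circ> r) n \<in> {z. \<phi> z \<le> ereal t}"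
      proof eventually_elim
        case (elim n)
        have "real_of_ereal (\<phi> (u (r n))) \<le> t"
          using u(2)[of "r n"] seq_suble[OF r(1), of n] elim by linarith
        then show ?case
          using eff_dom_finite[OF \<phi> u(1)] by (metis comp_apply ereal_less_eq(3) mem_Collect_eq)
      qed
      then show ?thesis
        using Lim_in_closed_set[OF closed_convex_fun_closed_sublevel[OF \<phi>] _ _ r(2)] by simp
    qed
    then have "\<phi> l = - \<infinity>"
      by (metis ereal_bot)
    then show False
      using \<phi> by (simp add: closed_convex_fun_def)
  qed
  with that show thesis
    by blast
qed

subsection \<open>The descent inequality\<close>

lemma cum_weight_eq: "cum_weight k = real k * (real k + 1) / 2"
  by (induction k) (auto simp: weight_def field_simps)

lemma cum_weight_nonneg: "0 \<le> cum_weight k"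
  by (simp add: cum_weight_eq)

lemma cum_weight_Suc_pos: "0 < cum_weight (Suc k)"
  by (simp add: cum_weight_eq)

lemma cum_weight_ratios:
  "0 \<le> cum_weight k / cum_weight (Suc k)" "0 \<le> weight (Suc k) / cum_weight (Suc k)"
  "cum_weight k / cum_weight (Suc k) + weight (Suc k) / cum_weight (Suc k) = 1"
  using cum_weight_nonneg[of k] cum_weight_Suc_pos[of k]
  by (auto simp: weight_def simp flip: add_divide_distrib)

text \<open>\<open>f'\<close> is a fixed selection of subgradients, later the expected oracle answer
  \<open>mean_grad P g\<close>. No probability enters here.\<close>

locale composite_problem = spd_matrix B for B :: "real^'n^'n" +
  fixes \<psi> f :: "real^'n \<Rightarrow> ereal" and f' :: "real^'n \<Rightarrow> real^'n" and D :: real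
  assumes psi: "closed_convex_fun \<psi>"
    and subgrad: "z \<in> eff_dom \<psi> \<Longrightarrow> f' z \<in> subdifferential f z"
    and D_pos: "0 < D"
    and diam: "z \<in> eff_dom \<psi> \<Longrightarrow> w \<in> eff_dom \<psi> \<Longrightarrow> norm_of B (z - w) \<le> D"
begin

text \<open>The real-valued form of F. It is meaningful only on \<open>eff_dom \<psi>\<close>, where
  \<open>objective_eq_obj\<close> identifies the two.\<close>

definition obj :: "real^'n \<Rightarrow> real" where
  "obj z = real_of_ereal (f z) + real_of_ereal (\<psi> z)"

lemma subgradient_ineq:
  assumes z: "z \<in> eff_dom \<psi>" and w: "w \<in> eff_dom \<psi>"
  shows "real_of_ereal (f z) + f' z \<bullet> (w - z) \<le> real_of_ereal (f w)"
proof -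
  have "f z = ereal (real_of_ereal (f z))" "f w = ereal (real_of_ereal (f w))"
    using subgrad[OF z] subgrad[OF w] by (auto simp: subdifferential_def ereal_real)
  moreover have "f z + ereal (f' z \<bullet> (w - z)) \<le> f w"
    using subgrad[OF z] by (simp add: subdifferential_def)
  ultimately show ?thesis
    by (metis ereal_less_eq(3) plus_ereal.simps(1))
qed

lemma objective_eq_obj:
  assumes "z \<in> eff_dom \<psi>"
  shows "f z + \<psi> z = ereal (obj z)"
proof -
  have "f z = ereal (real_of_ereal (f z))"
    using subgrad[OF assms] by (auto simp: subdifferential_def ereal_real)
  then show ?thesis
    unfolding obj_def using eff_dom_finite[OF psi assms] by (metis plus_ereal.simps(1))
qed

lemma bounded_eff_dom: "bounded (eff_dom \<psi>)"
proof (cases "eff_dom \<psi> = {}")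
  case False
  then obtain z where z: "z \<in> eff_dom \<psi>"
    by blast
  obtain K where K: "0 < K" "\<And>x. norm x \<le> K * norm_of B x"
    using norm_le_norm_of by blast
  have "dist z w \<le> K * D" if "w \<in> eff_dom \<psi>" for w
    using order_trans[OF K(2) mult_left_mono[OF diam[OF z that]]] K(1) by (simp add: dist_norm)
  then show ?thesis
    unfolding bounded_def by blast
qed simp

text \<open>A subgradient at one fixed point minorises f by an affine function, which varies
  boundedly over a domain of diameter at most \<open>D\<close>; \<psi> is bounded below there as
  well. This supplies the lower half of the integrability of F(x_k).\<close>

lemma obj_bounded_below:
  obtains m where "\<And>z. z \<in> eff_dom \<psi> \<Longrightarrow> m \<le> obj z"
proof (cases "eff_dom \<psi> = {}")
  case False
  then obtain z where z: "z \<in> eff_dom \<psi>"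
    by blast
  obtain m where m: "\<And>w. w \<in> eff_dom \<psi> \<Longrightarrow> m \<le> real_of_ereal (\<psi> w)"
    using closed_convex_fun_bounded_below[OF psi bounded_eff_dom] by blast
  have "real_of_ereal (f z) - dual_norm_of B (f' z) * D + m \<le> obj w" if w: "w \<in> eff_dom \<psi>" for w
  proof -
    have "- (f' z \<bullet> (w - z)) \<le> dual_norm_of B (f' z) * norm_of B (z - w)"
      using inner_le_dual_norm[of "f' z" "z - w"] by (simp add: inner_diff_right)
    also have "\<dots> \<le> dual_norm_of B (f' z) * D"
      by (rule mult_left_mono[OF diam[OF z w]]) simp
    finally show ?thesis
      using subgradient_ineq[OF z w] m[OF w] by (simp add: obj_def)
  qed
  with that show thesis
    by blast
qed (use that in blast)

text \<open>Moving from the minimiser w a fraction t towards z, dividing by t and letting t tend to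
  0 gives the first-order condition without differentiating \<psi>. The extra term in z - w is the
  gain from the quadratic; h = 0, as in the first iteration, is covered.\<close>

lemma prox_optimality:
  assumes min: "is_arg_min
      (\<lambda>z. ereal a * (ereal (s \<bullet> z) + \<psi> z) + ereal (h / 2 * (norm_of B (z - u))\<^sup>2))
      (\<lambda>z. z \<in> eff_dom \<psi>) w"
    and a: "0 < a" and z: "z \<in> eff_dom \<psi>"
  shows "a * (s \<bullet> w + real_of_ereal (\<psi> w)) + h / 2 * (norm_of B (w - u))\<^sup>2 + h / 2 * (norm_of B (z - w))\<^sup>2
    \<le> a * (s \<bullet> z + real_of_ereal (\<psi> z)) + h / 2 * (norm_of B (z - u))\<^sup>2"
proof -
  define \<phi> where "\<phi> = (\<lambda>z. real_of_ereal (\<psi> z))"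
  define Q where "Q = (\<lambda>z. a * (s \<bullet> z + \<phi> z) + h / 2 * (norm_of B (z - u))\<^sup>2)"
  have Q: "ereal a * (ereal (s \<bullet> z) + \<psi> z) + ereal (h / 2 * (norm_of B (z - u))\<^sup>2) = ereal (Q z)"
    if "z \<in> eff_dom \<psi>" for z
  proof -
    have "\<psi> z = ereal (\<phi> z)"
      unfolding \<phi>_def by (rule eff_dom_finite[OF psi that])
    then show ?thesis
      by (simp add: Q_def)
  qed
  have w: "w \<in> eff_dom \<psi>"
    using min by (simp add: is_arg_min_def)
  have min': "Q w \<le> Q z'" if "z' \<in> eff_dom \<psi>" for z'
  proof -
    have "\<not> ereal (Q z') < ereal (Q w)"
      using min that w Q[OF that] Q[OF w] unfolding is_arg_min_def by metis
    then show ?thesis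
      by simp
  qed
  \<comment> \<open>\<open>N\<close> is the derivative at w, in the direction z - w, of the
    quadratic term centred at u.\<close>
  define N where "N = h * ((B *v (w - u)) \<bullet> (z - w))"
  have "0 \<le> (a * (s \<bullet> (z - w) + \<phi> z - \<phi> w) + N) + t * (h / 2 * (norm_of B (z - w))\<^sup>2)"
    if t: "0 < t" "t \<le> 1" for t
  proof -
    define z' where "z' = (1 - t) *\<^sub>R w + t *\<^sub>R z"
    have z': "z' \<in> eff_dom \<psi>" "\<phi> z' \<le> (1 - t) * \<phi> w + t * \<phi> z"
      using closed_convex_fun_combination[OF psi w z, of "1 - t" t] t by (auto simp: z'_def \<phi>_def)
    have "z' - u = (w - u) + t *\<^sub>R (z - w)"
      by (simp add: z'_def algebra_simps)
    then have sq: "(norm_of B (z' - u))\<^sup>2 =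
        (norm_of B (w - u))\<^sup>2 + 2 * (t * ((B *v (w - u)) \<bullet> (z - w))) + t\<^sup>2 * (norm_of B (z - w))\<^sup>2"
      by (simp only: norm_of_add_square norm_of_scale power_mult_distrib) simp
    have inner_z': "s \<bullet> z' = s \<bullet> w + t * (s \<bullet> (z - w))"
      by (simp add: z'_def inner_add_right inner_diff_right algebra_simps)
    have "Q w \<le> Q z'"
      by (rule min'[OF z'(1)])
    also have "Q z' \<le> a * (s \<bullet> z' + ((1 - t) * \<phi> w + t * \<phi> z)) + h / 2 * (norm_of B (z' - u))\<^sup>2"
      using z'(2) a by (simp add: Q_def)
    also have "\<dots> = Q w + t * ((a * (s \<bullet> (z - w) + \<phi> z - \<phi> w) + N) + t * (h / 2 * (norm_of B (z - w))\<^sup>2))"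
      unfolding Q_def sq N_def inner_z'
      by (simp add: inner_diff_right algebra_simps power2_eq_square add_divide_distrib)
    finally show ?thesis
      using t by (simp add: zero_le_mult_iff)
  qed
  then have *: "0 \<le> a * (s \<bullet> (z - w) + \<phi> z - \<phi> w) + N"
    by (rule nonneg_of_affine_nonneg)
  \<comment> \<open>Three-point identity: it rewrites \<open>N\<close> as a difference of squared
    norms.\<close>
  have "(norm_of B (z - u))\<^sup>2 = (norm_of B ((w - u) + (z - w)))\<^sup>2"
    by simp
  also have "\<dots> = (norm_of B (w - u))\<^sup>2 + 2 * ((B *v (w - u)) \<bullet> (z - w)) + (norm_of B (z - w))\<^sup>2"
    by (rule norm_of_add_square)
  finally have "N = h / 2 * ((norm_of B (z - u))\<^sup>2 - (norm_of B (w - u))\<^sup>2 - (norm_of B (z - w))\<^sup>2)"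
    by (simp add: N_def)
  with * show ?thesis
    by (simp add: \<phi>_def inner_diff_right algebra_simps)
qed

end

text \<open>One fixed trajectory: \<open>gy\<close> and \<open>gx\<close> are arbitrary vectors
  here, so all results hold pathwise.\<close>

locale usfgm = composite_problem B \<psi> f f' D
  for B :: "real^'n^'n" and \<psi> f :: "real^'n \<Rightarrow> ereal" and f' :: "real^'n \<Rightarrow> real^'n" and D :: real +
  fixes x0 :: "real^'n" and gy gx x v y :: "nat \<Rightarrow> real^'n" and H :: "nat \<Rightarrow> real"
  assumes run: "usfgm_run B \<psi> D x0 gy gx x v y H"
begin

section \<open>Feasibility of the iterates and the recursion for \<open>H\<close>\<close>

lemma init: "x 0 = x0" "v 0 = x0" "H 0 = 0" "x0 \<in> eff_dom \<psi>"
  using run by (auto simp: usfgm_run_def)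

abbreviation r :: "nat \<Rightarrow> real" where
  "r k \<equiv> norm_of B (v (Suc k) - v k)"

abbreviation \<beta> :: "nat \<Rightarrow> real" where
  "\<beta> k \<equiv> (gx (Suc k) - gy k) \<bullet> (x (Suc k) - y k)"

lemma y_eq: "y k = (cum_weight k / cum_weight (Suc k)) *\<^sub>R x k + (weight (Suc k) / cum_weight (Suc k)) *\<^sub>R v k"
  using run unfolding usfgm_run_def Let_def by blast

lemma x_Suc: "x (Suc k) = (cum_weight k / cum_weight (Suc k)) *\<^sub>R x k + (weight (Suc k) / cum_weight (Suc k)) *\<^sub>R v (Suc k)"
  using run unfolding usfgm_run_def Let_def by blast

lemma H_Suc: "H (Suc k) = H k + max (cum_weight (Suc k) * \<beta> k - H k * (r k)\<^sup>2 / 2) 0 / (D\<^sup>2 + (r k)\<^sup>2 / 2)"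
  using run unfolding usfgm_run_def Let_def by blast

lemma v_Suc: "is_arg_min
    (\<lambda>z. ereal (weight (Suc k)) * (ereal (gy k \<bullet> z) + \<psi> z) + ereal (H k / 2 * (norm_of B (z - v k))\<^sup>2))
    (\<lambda>z. z \<in> eff_dom \<psi>) (v (Suc k))"
  using run unfolding usfgm_run_def Let_def by blast

lemma v_dom: "v k \<in> eff_dom \<psi>"
  using init v_Suc by (cases k) (auto simp: is_arg_min_def)

lemma x_dom: "x k \<in> eff_dom \<psi>"
proof (induction k)
  case (Suc k)
  then show ?case
    unfolding x_Suc using closed_convex_fun_combination(1)[OF psi _ v_dom] cum_weight_ratios[of k] by blast
qed (use init in simp)

lemma y_dom: "y k \<in> eff_dom \<psi>"
  unfolding y_eq using closed_convex_fun_combination(1)[OF psi x_dom v_dom] cum_weight_ratios[of k] by blast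

lemma r_le: "r k \<le> D"
  using diam v_dom by blast

lemma denominator_pos: "0 < D\<^sup>2 + (r k)\<^sup>2 / 2"
  using D_pos by (auto intro: add_pos_nonneg)

lemma H_mono: "H k \<le> H (Suc k)"
  unfolding H_Suc using denominator_pos[of k] by simp

lemma H_nonneg: "0 \<le> H k"
  by (induction k) (use init H_mono order_trans in auto)

lemma H_increment:
  "(H (Suc k) - H k) * (D\<^sup>2 + (r k)\<^sup>2 / 2) = max (cum_weight (Suc k) * \<beta> k - H k * (r k)\<^sup>2 / 2) 0"
  unfolding H_Suc using denominator_pos[of k] by simp

text \<open>Clearing the denominator and moving the increment times r^2 / 2 into the bracket
  replaces H_k there by H_{k+1}. A large new value thus limits its own increment. If the bracket is
  not positive, \<open>H\<close> stays constant and both sides vanish.\<close>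

lemma H_increment_implicit:
  "D\<^sup>2 * (H (Suc k) - H k) = max (cum_weight (Suc k) * \<beta> k - H (Suc k) * (r k)\<^sup>2 / 2) 0"
proof (cases "cum_weight (Suc k) * \<beta> k - H k * (r k)\<^sup>2 / 2 \<le> 0")
  case True
  then have "H (Suc k) = H k"
    unfolding H_Suc by simp
  with True show ?thesis
    by simp
next
  case False
  then have "(H (Suc k) - H k) * (D\<^sup>2 + (r k)\<^sup>2 / 2) = cum_weight (Suc k) * \<beta> k - H k * (r k)\<^sup>2 / 2"
    using H_increment[of k] by simp
  moreover have "D\<^sup>2 * (h' - h) = b - h' * s / 2" if "(h' - h) * (D\<^sup>2 + s / 2) = b - h * s / 2" for h h' s b :: real
    using that by (simp add: field_simps)
  ultimately have "D\<^sup>2 * (H (Suc k) - H k) = cum_weight (Suc k) * \<beta> k - H (Suc k) * (r k)\<^sup>2 / 2"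
    by blast
  moreover have "0 \<le> D\<^sup>2 * (H (Suc k) - H k)"
    using H_mono[of k] by simp
  ultimately show ?thesis
    by simp
qed

text \<open>The points y_k and x_{k+1} are the same combination, except that v_k is exchanged for
  v_{k+1}.\<close>

lemma x_diff: "cum_weight (Suc k) *\<^sub>R (x (Suc k) - y k) = weight (Suc k) *\<^sub>R (v (Suc k) - v k)"
  unfolding x_Suc y_eq using cum_weight_Suc_pos[of k]
  by (simp add: scaleR_right_diff_distrib scaleR_add_right del: cum_weight.simps)

lemma norm_x_diff: "norm_of B (x (Suc k) - y k) = weight (Suc k) / cum_weight (Suc k) * r k"
proof -
  have "norm_of B (cum_weight (Suc k) *\<^sub>R (x (Suc k) - y k)) = norm_of B (weight (Suc k) *\<^sub>R (v (Suc k) - v k))"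
    by (simp only: x_diff)
  then have "cum_weight (Suc k) * norm_of B (x (Suc k) - y k) = weight (Suc k) * r k"
    using cum_weight_Suc_pos[of k] by (simp add: norm_of_scale weight_def del: cum_weight.simps)
  then show ?thesis
    using cum_weight_Suc_pos[of k] by (simp add: field_simps del: cum_weight.simps)
qed

text \<open>The contribution of the oracle errors. Each error is paired with a vector that is
  determined before the corresponding sample is drawn.\<close>

definition noise :: "real^'n \<Rightarrow> nat \<Rightarrow> real" where
  "noise z k = weight (Suc k) * ((gy k - f' (y k)) \<bullet> (z - v k))
     - cum_weight (Suc k) * ((gx (Suc k) - f' (x (Suc k))) \<bullet> (x (Suc k) - y k))"

text \<open>Sum of five inequalities: convexity of \<psi> at x_{k+1}, optimality of v_{k+1}, the
  subgradient inequality at y_k towards x_k and towards z, and the one at x_{k+1} towards y_k. The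
  term \<beta> appears because the last uses the answer at x_{k+1} while the proximal step used the
  one at y_k.\<close>

lemma descent:
  assumes z: "z \<in> eff_dom \<psi>"
  shows "cum_weight (Suc k) * (obj (x (Suc k)) - obj z) + H k / 2 * (norm_of B (z - v (Suc k)))\<^sup>2
    \<le> cum_weight k * (obj (x k) - obj z) + H k / 2 * (norm_of B (z - v k))\<^sup>2
      + (cum_weight (Suc k) * \<beta> k - H k * (r k)\<^sup>2 / 2) + noise z k"
proof -
  define A A' a where "A = cum_weight k" and "A' = cum_weight (Suc k)" and "a = weight (Suc k)"
  have A: "0 \<le> A" "0 < A'" "0 < a" "A' = A + a"
    using cum_weight_nonneg cum_weight_Suc_pos by (auto simp: A_def A'_def a_def weight_def)
  define fr \<phi> where "fr = (\<lambda>z. real_of_ereal (f z))" and "\<phi> = (\<lambda>z. real_of_ereal (\<psi> z))"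
  have "\<phi> (x (Suc k)) \<le> A / A' * \<phi> (x k) + a / A' * \<phi> (v (Suc k))"
    unfolding x_Suc \<phi>_def A_def A'_def a_def
    using closed_convex_fun_combination(2)[OF psi x_dom v_dom cum_weight_ratios] .
  then have "A' * \<phi> (x (Suc k)) \<le> A' * (A / A' * \<phi> (x k) + a / A' * \<phi> (v (Suc k)))"
    using A(2) by simp
  also have "\<dots> = A * \<phi> (x k) + a * \<phi> (v (Suc k))"
    using A(2) by (simp add: distrib_left)
  finally have 1: "A' * \<phi> (x (Suc k)) \<le> A * \<phi> (x k) + a * \<phi> (v (Suc k))" .
  have 2: "a * (gy k \<bullet> v (Suc k) + \<phi> (v (Suc k))) + H k / 2 * (r k)\<^sup>2 + H k / 2 * (norm_of B (z - v (Suc k)))\<^sup>2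
      \<le> a * (gy k \<bullet> z + \<phi> z) + H k / 2 * (norm_of B (z - v k))\<^sup>2"
    using prox_optimality[OF v_Suc _ z] A(3) by (simp add: a_def \<phi>_def)
  have 3: "A * (fr (y k) + f' (y k) \<bullet> (x k - y k)) \<le> A * fr (x k)"
    using subgradient_ineq[OF y_dom x_dom] A(1) by (simp add: fr_def mult_left_mono)
  have 4: "a * (fr (y k) + f' (y k) \<bullet> (z - y k)) \<le> a * fr z"
    using subgradient_ineq[OF y_dom z] A(3) by (simp add: fr_def mult_left_mono)
  have 5: "A' * (fr (x (Suc k)) + f' (x (Suc k)) \<bullet> (y k - x (Suc k))) \<le> A' * fr (y k)"
    using subgradient_ineq[OF x_dom y_dom] A(2) by (simp add: fr_def mult_left_mono)
  have "A *\<^sub>R x k + a *\<^sub>R v k = A' *\<^sub>R y k"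
    unfolding y_eq A_def A'_def a_def using cum_weight_Suc_pos[of k]
    by (simp add: scaleR_add_right del: cum_weight.simps)
  \<comment> \<open>With weights A and a, the two linearisations at y_k combine into a single linear
    term in z - v_k.\<close>
  then have "A *\<^sub>R (x k - y k) + a *\<^sub>R (z - y k) = a *\<^sub>R (z - v k)"
    using A(4) by (simp add: algebra_simps)
  then have 6: "A * (f' (y k) \<bullet> (x k - y k)) + a * (f' (y k) \<bullet> (z - y k)) = a * (f' (y k) \<bullet> (z - v k))"
    by (metis inner_add_right inner_scaleR_right)
  have 7: "A' * (gy k \<bullet> (x (Suc k) - y k)) = a * (gy k \<bullet> (v (Suc k) - v k))"
    using x_diff[of k] unfolding A'_def a_def by (metis inner_scaleR_right)
  have 8: "A' * \<beta> k = A' * (gx (Suc k) \<bullet> (x (Suc k) - y k)) - A' * (gy k \<bullet> (x (Suc k) - y k))"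
    by (simp add: inner_diff_left right_diff_distrib)
  have 9: "noise z k = a * (gy k \<bullet> (z - v k)) - a * (f' (y k) \<bullet> (z - v k))
      - A' * (gx (Suc k) \<bullet> (x (Suc k) - y k)) + A' * (f' (x (Suc k)) \<bullet> (x (Suc k) - y k))"
    unfolding noise_def A'_def a_def by (simp add: inner_diff_left right_diff_distrib)
  have 10: "f' (x (Suc k)) \<bullet> (y k - x (Suc k)) = - (f' (x (Suc k)) \<bullet> (x (Suc k) - y k))"
    by (simp add: inner_diff_right)
  have 11: "a * (gy k \<bullet> z) - a * (gy k \<bullet> v (Suc k)) = a * (gy k \<bullet> (z - v k)) - a * (gy k \<bullet> (v (Suc k) - v k))"
    by (simp add: inner_diff_right right_diff_distrib)
  have 12: "A' * fr (y k) = A * fr (y k) + a * fr (y k)" "A' * (fr z + \<phi> z) = A * (fr z + \<phi> z) + a * (fr z + \<phi> z)"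
    using A(4) by (simp_all add: distrib_right)
  have obj: "obj w = fr w + \<phi> w" for w
    by (simp add: obj_def fr_def \<phi>_def)
  show ?thesis
    unfolding obj A_def [symmetric] A'_def [symmetric]
    using 1 2 3 4 5 [unfolded 10] 6 7 8 9 11 12
    by (simp only: distrib_left right_diff_distrib mult_minus_right)
qed

text \<open>Raising H_k to H_{k+1} in front of the new distance costs D^2 / 2 per unit of increment,
  and the bracket is at most the increment times D^2 + r^2 / 2, where r is at most D. Together this
  is 1/2 + 3/2 = 2 times D^2.\<close>

lemma potential_decrease:
  assumes z: "z \<in> eff_dom \<psi>"
  shows "cum_weight (Suc k) * (obj (x (Suc k)) - obj z) + H (Suc k) / 2 * (norm_of B (z - v (Suc k)))\<^sup>2
    \<le> cum_weight k * (obj (x k) - obj z) + H k / 2 * (norm_of B (z - v k))\<^sup>2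
      + 2 * D\<^sup>2 * (H (Suc k) - H k) + noise z k"
proof -
  have d: "(norm_of B w)\<^sup>2 \<le> D\<^sup>2" if "norm_of B w \<le> D" for w
    using that by (rule power_mono) simp
  have "(H (Suc k) - H k) / 2 * (norm_of B (z - v (Suc k)))\<^sup>2 \<le> (H (Suc k) - H k) / 2 * D\<^sup>2"
    using d[OF diam[OF z v_dom]] H_mono[of k] by (intro mult_left_mono) auto
  moreover have "cum_weight (Suc k) * \<beta> k - H k * (r k)\<^sup>2 / 2 \<le> (H (Suc k) - H k) * (D\<^sup>2 + (r k)\<^sup>2 / 2)"
    unfolding H_increment by simp
  moreover have "(H (Suc k) - H k) * (D\<^sup>2 + (r k)\<^sup>2 / 2) \<le> (H (Suc k) - H k) * (D\<^sup>2 + D\<^sup>2 / 2)"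
    using d[OF r_le] H_mono[of k] by (intro mult_left_mono) auto
  ultimately show ?thesis
    using descent[OF z, of k] by (simp add: algebra_simps diff_divide_distrib del: cum_weight.simps)
qed

text \<open>Telescoping; the initial potential is zero because both A_0 and H_0 vanish.\<close>

lemma gap_bound:
  assumes z: "z \<in> eff_dom \<psi>"
  shows "cum_weight k * (obj (x k) - obj z) \<le> 2 * D\<^sup>2 * H k + (\<Sum>i<k. noise z i)"
proof -
  have "cum_weight k * (obj (x k) - obj z) + H k / 2 * (norm_of B (z - v k))\<^sup>2
      \<le> 2 * D\<^sup>2 * H k + (\<Sum>i<k. noise z i)"
  proof (induction k)
    case (Suc k)
    then show ?case
      using potential_decrease[OF z, of k] by (simp add: right_diff_distrib del: cum_weight.simps)
  qed (simp add: init)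
  moreover have "0 \<le> H k / 2 * (norm_of B (z - v k))\<^sup>2"
    using H_nonneg by simp
  ultimately show ?thesis
    by linarith
qed

end

subsection \<open>Growth of the curvature estimates\<close>

text \<open>Weighted arithmetic-geometric mean of s and 1, that is, the tangent of a concave power
  at 1.\<close>

lemma powr_le_affine:
  fixes s p :: real
  assumes "0 \<le> s" "0 \<le> p" "p \<le> 1"
  shows "s powr p \<le> p * s + (1 - p)"
  using Youngs_inequality_0[of p "1 - p" s 1] assms by (cases "s = 0") auto

text \<open>Putting t = 1 - 1/n, the claim becomes t^q \<le> 1 - (1 - \<nu>) (1 - t). For q \<le> 1
  the tangent at 1 has slope q \<ge> 1 - \<nu>; for q > 1 use t^q \<le> t.\<close>

lemma powr_increment_ge:
  fixes n \<nu> :: real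
  assumes n: "1 \<le> n" and \<nu>: "0 \<le> \<nu>" "\<nu> \<le> 1"
  defines "q \<equiv> 3 * (1 - \<nu>) / 2"
  shows "(1 - \<nu>) * n powr (q - 1) \<le> n powr q - (n - 1) powr q"
proof -
  define t where "t = 1 - 1 / n"
  have t: "0 \<le> t" "t \<le> 1" "n - 1 = n * t" "1 - t = 1 / n"
    using n by (auto simp: t_def field_simps)
  have "t powr q \<le> 1 - (1 - \<nu>) * (1 - t)"
  proof (cases "q \<le> 1")
    case True
    have "t powr q \<le> q * t + (1 - q)"
      using powr_le_affine[of t q] t \<nu> True by (simp add: q_def)
    also have "\<dots> \<le> 1 - (1 - \<nu>) * (1 - t)"
    proof -
      have "(1 - \<nu>) * (1 - t) \<le> q * (1 - t)"
        using t(2) \<nu> by (intro mult_right_mono) (auto simp: q_def)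
      then show ?thesis
        by (simp add: algebra_simps)
    qed
    finally show ?thesis .
  next
    case False
    have "t powr q \<le> t powr 1"
      using False t by (intro powr_mono') auto
    moreover have "(1 - \<nu>) * (1 - t) \<le> 1 * (1 - t)"
      using t(2) \<nu> by (intro mult_right_mono) auto
    ultimately show ?thesis
      using t by simp
  qed
  then have "n powr q * t powr q \<le> n powr q * (1 - (1 - \<nu>) * (1 - t))"
    by (intro mult_left_mono) auto
  moreover have "(n - 1) powr q = n powr q * t powr q"
    using t n by (simp add: powr_mult)
  moreover have "n powr q * (1 / n) = n powr (q - 1)"
    using n by (simp add: powr_diff)
  moreover have "n powr q * (1 - (1 - \<nu>) * (1 / n)) = n powr q - (1 - \<nu>) * (n powr q * (1 / n))"
    by (simp add: algebra_simps)
  ultimately show ?thesis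
    unfolding t(4) by simp
qed

text \<open>Here \<rho> stands for r_k / D. After factoring out n^(q - 1), Young's inequality bounds
  the Hoelder term by 2 s^2 + (1 - \<nu>), and the quadratic term cancels 2 s^2. The factor 2 is a
  quarter of the constant 8 in the bound on \<open>H\<close>.\<close>

lemma hoelder_increment_bound:
  fixes n \<nu> \<rho> :: real
  assumes n: "1 \<le> n" and \<nu>: "0 \<le> \<nu>" "\<nu> \<le> 1" and \<rho>: "0 \<le> \<rho>"
  defines "q \<equiv> 3 * (1 - \<nu>) / 2"
  shows "n * (2 / (n + 1)) powr \<nu> * \<rho> powr (1 + \<nu>) - 2 * n powr q * \<rho>\<^sup>2
    \<le> 8 * (n powr q - (n - 1) powr q)"
proof -
  \<comment> \<open>The maximiser over \<open>\<rho>\<close> scales like \<open>n\<close> to the power -1/2.\<close>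
  define s where "s = \<rho> * sqrt n"
  have s: "0 \<le> s" "\<rho> = s * n powr (- 1 / 2)"
    using n \<rho> by (auto simp: s_def powr_half_sqrt powr_minus_divide)
  have "(2 / (n + 1)) powr \<nu> \<le> (2 / n) powr \<nu>"
    using n \<nu> by (intro powr_mono2) (auto simp: field_simps)
  also have "\<dots> = 2 powr \<nu> * n powr (- \<nu>)"
    using n by (simp add: powr_divide powr_minus_divide)
  finally have "n * (2 / (n + 1)) powr \<nu> * \<rho> powr (1 + \<nu>) \<le> n * (2 powr \<nu> * n powr (- \<nu>)) * \<rho> powr (1 + \<nu>)"
    using n by (intro mult_right_mono mult_left_mono) auto
  also have "\<dots> = 2 powr \<nu> * s powr (1 + \<nu>) * (n powr 1 * n powr (- \<nu>) * n powr (- 1 / 2 * (1 + \<nu>)))"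
    using n s by (simp add: powr_mult powr_powr)
  \<comment> \<open>The exponents add up to 1 - \<nu> - (1 + \<nu>) / 2 = (1 - 3 \<nu>) / 2 = q -
    1.\<close>
  also have "n powr 1 * n powr (- \<nu>) * n powr (- 1 / 2 * (1 + \<nu>)) = n powr (q - 1)"
    by (simp only: powr_add [symmetric]) (simp add: q_def field_simps)
  finally have 1: "n * (2 / (n + 1)) powr \<nu> * \<rho> powr (1 + \<nu>) \<le> 2 powr \<nu> * s powr (1 + \<nu>) * n powr (q - 1)" .
  have 2: "n powr q * \<rho>\<^sup>2 = n powr (q - 1) * s\<^sup>2"
    using n by (simp add: s_def power_mult_distrib powr_diff)
  have "s\<^sup>2 = s powr 2"
    using s(1) by simp
  then have "s powr (1 + \<nu>) = (s\<^sup>2) powr ((1 + \<nu>) / 2)"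
    by (simp only: powr_powr) (simp add: add_divide_distrib distrib_left)
  also have "\<dots> \<le> (1 + \<nu>) / 2 * s\<^sup>2 + (1 - (1 + \<nu>) / 2)"
    using \<nu> by (intro powr_le_affine) auto
  finally have "2 powr \<nu> * s powr (1 + \<nu>) \<le> 2 powr \<nu> * ((1 + \<nu>) / 2 * s\<^sup>2 + (1 - (1 + \<nu>) / 2))"
    by (intro mult_left_mono) auto
  also have "\<dots> \<le> 2 * ((1 + \<nu>) / 2 * s\<^sup>2 + (1 - (1 + \<nu>) / 2))"
    using \<nu> powr_mono[of \<nu> 1 "2::real"] by (intro mult_right_mono) auto
  also have "\<dots> = (1 + \<nu>) * s\<^sup>2 + (1 - \<nu>)"
    by (simp add: field_simps)
  also have "\<dots> \<le> 2 * s\<^sup>2 + (1 - \<nu>)"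
    using mult_right_mono[of "1 + \<nu>" 2 "s\<^sup>2"] \<nu> by simp
  also have "\<dots> \<le> 2 * s\<^sup>2 + 8 * (1 - \<nu>)"
    using \<nu> by simp
  finally have "n powr (q - 1) * (2 powr \<nu> * s powr (1 + \<nu>)) \<le> n powr (q - 1) * (2 * s\<^sup>2 + 8 * (1 - \<nu>))"
    by (intro mult_left_mono) auto
  then have "n * (2 / (n + 1)) powr \<nu> * \<rho> powr (1 + \<nu>) - 2 * n powr q * \<rho>\<^sup>2 \<le> 8 * ((1 - \<nu>) * n powr (q - 1))"
    using 1 2 by (simp add: algebra_simps)
  also have "\<dots> \<le> 8 * (n powr q - (n - 1) powr q)"
    using powr_increment_ge[OF n \<nu>] by (simp add: q_def)
  finally show ?thesis .
qed

text \<open>This is what makes only the square root of the accumulated squared errors enter the bound on \<open>H\<close>.\<close>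

lemma implicit_sqrt_step:
  fixes h h' b b' N N' :: real
  assumes h: "h \<le> b + N" and N: "0 \<le> N" "N \<le> N'" and b': "0 \<le> b'"
    and step: "b' < h' \<Longrightarrow> h' - h \<le> (b' - b) + (N'\<^sup>2 - N\<^sup>2) / (2 * h')"
  shows "h' \<le> b' + N'"
proof (cases "b' < h'")
  case True
  \<comment> \<open>The excess over the deterministic part. It is at most h', so it may replace h'
    in the denominator; the resulting quadratic inequality for u gives u \<le> N' after completing
    the square.\<close>
  define u where "u = h' - b'"
  have u: "0 < u" "u \<le> h'"
    using True b' by (auto simp: u_def)
  have "0 \<le> N'\<^sup>2 - N\<^sup>2"
    using N by (simp add: power_mono)
  then have "(N'\<^sup>2 - N\<^sup>2) / (2 * h') \<le> (N'\<^sup>2 - N\<^sup>2) / (2 * u)"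
    using u by (intro divide_left_mono) auto
  then have "u \<le> N + (N'\<^sup>2 - N\<^sup>2) / (2 * u)"
    using step[OF True] h by (simp add: u_def)
  then have "u * (2 * u) \<le> (N + (N'\<^sup>2 - N\<^sup>2) / (2 * u)) * (2 * u)"
    using u by (intro mult_right_mono) auto
  also have "\<dots> = 2 * N * u + (N'\<^sup>2 - N\<^sup>2)"
    using u by (simp add: field_simps)
  finally have "u\<^sup>2 + (u - N)\<^sup>2 \<le> N'\<^sup>2"
    by (simp add: power2_eq_square algebra_simps)
  then have "u\<^sup>2 \<le> N'\<^sup>2"
    using zero_le_power2[of "u - N"] by linarith
  then have "u \<le> N'"
    using N by (auto intro: power2_le_imp_le [of u N'])
  then show ?thesis
    by (simp add: u_def)
next
  case False
  then show ?thesis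
    using N by simp
qed

section \<open>The Hoelder condition and the pathwise bound on \<open>H\<close>\<close>

context composite_problem
begin

lemma hoelder_const_bound:
  assumes fin: "hoelder_const B \<psi> f \<nu> < \<infinity>" and z: "z \<in> eff_dom \<psi>" and w: "w \<in> eff_dom \<psi>"
  shows "(f' z - f' w) \<bullet> (z - w) \<le> enn2real (hoelder_const B \<psi> f \<nu>) * norm_of B (z - w) powr (1 + \<nu>)"
proof (cases "z = w")
  case False
  then have pos: "0 < norm_of B (z - w)"
    by (simp add: norm_of_pos)
  have "ennreal (dual_norm_of B (f' z - f' w) / norm_of B (z - w) powr \<nu>) \<le> hoelder_const B \<psi> f \<nu>"
    unfolding hoelder_const_def
    by (intro Sup_upper CollectI exI [of _ z] exI [of _ w] exI [of _ "f' z"] exI [of _ "f' w"] conjI refl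
        z w False subgrad)
  then have "ennreal (dual_norm_of B (f' z - f' w) / norm_of B (z - w) powr \<nu>)
      \<le> ennreal (enn2real (hoelder_const B \<psi> f \<nu>))"
    using fin by (simp add: ennreal_enn2real)
  then have "dual_norm_of B (f' z - f' w) \<le> enn2real (hoelder_const B \<psi> f \<nu>) * norm_of B (z - w) powr \<nu>"
    using pos by (simp add: ennreal_le_iff divide_le_eq)
  then have "dual_norm_of B (f' z - f' w) * norm_of B (z - w)
      \<le> enn2real (hoelder_const B \<psi> f \<nu>) * norm_of B (z - w) powr \<nu> * norm_of B (z - w)"
    using pos by (intro mult_right_mono) auto
  also have "\<dots> = enn2real (hoelder_const B \<psi> f \<nu>) * norm_of B (z - w) powr (1 + \<nu>)"
    using pos by (simp add: powr_add)
  finally show ?thesis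
    by (rule order_trans [OF inner_le_dual_norm])
qed simp

end

context usfgm
begin

definition \<delta> :: "nat \<Rightarrow> real" where
  "\<delta> k = dual_norm_of B ((gx (Suc k) - f' (x (Suc k))) - (gy k - f' (y k)))"

text \<open>Split the difference of the answers into the difference of exact subgradients,
  controlled by the Hoelder condition, and the difference of the errors, controlled by
  duality.\<close>

lemma weighted_\<beta>_le:
  assumes \<nu>: "0 \<le> \<nu>" "\<nu> \<le> 1" and fin: "hoelder_const B \<psi> f \<nu> < \<infinity>"
  shows "cum_weight (Suc k) * \<beta> k
    \<le> enn2real (hoelder_const B \<psi> f \<nu>) * (real (Suc k) * (2 / (real (Suc k) + 1)) powr \<nu> * r k powr (1 + \<nu>))
      + real (Suc k) * \<delta> k * r k"
proof -
  define L where "L = enn2real (hoelder_const B \<psi> f \<nu>)"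
  \<comment> \<open>The ratio a_{k+1} / A_{k+1} = 2 / (k + 2), by which the step from y_k to x_{k+1}
    is shorter than r_k.\<close>
  define c where "c = 2 / (real (Suc k) + 1)"
  have c: "0 < c" "weight (Suc k) / cum_weight (Suc k) = c" "cum_weight (Suc k) * c = real (Suc k)"
    by (auto simp: c_def cum_weight_eq weight_def divide_simps simp del: cum_weight.simps of_nat_Suc)
  have "\<beta> k = (f' (x (Suc k)) - f' (y k)) \<bullet> (x (Suc k) - y k)
      + ((gx (Suc k) - f' (x (Suc k))) - (gy k - f' (y k))) \<bullet> (x (Suc k) - y k)"
    by (simp add: inner_diff_left)
  also have "\<dots> \<le> L * (c * r k) powr (1 + \<nu>) + \<delta> k * (c * r k)"
  proof (rule add_mono)
    show "(f' (x (Suc k)) - f' (y k)) \<bullet> (x (Suc k) - y k) \<le> L * (c * r k) powr (1 + \<nu>)"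
      using hoelder_const_bound[OF fin x_dom y_dom, of "Suc k" k] unfolding L_def norm_x_diff c(2) .
    show "((gx (Suc k) - f' (x (Suc k))) - (gy k - f' (y k))) \<bullet> (x (Suc k) - y k) \<le> \<delta> k * (c * r k)"
      using inner_le_dual_norm[of "(gx (Suc k) - f' (x (Suc k))) - (gy k - f' (y k))" "x (Suc k) - y k"]
      unfolding \<delta>_def norm_x_diff c(2) .
  qed
  finally have "cum_weight (Suc k) * \<beta> k \<le> cum_weight (Suc k) * (L * (c * r k) powr (1 + \<nu>) + \<delta> k * (c * r k))"
    using cum_weight_nonneg by (intro mult_left_mono)
  also have "\<dots> = L * ((cum_weight (Suc k) * c) * c powr \<nu> * r k powr (1 + \<nu>)) + (cum_weight (Suc k) * c) * \<delta> k * r k"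
  proof -
    have "(c * r k) powr (1 + \<nu>) = c * c powr \<nu> * r k powr (1 + \<nu>)"
      using c(1) by (simp add: powr_mult powr_mult_base)
    then show ?thesis
      by (simp only: distrib_left mult_ac)
  qed
  finally show ?thesis
    unfolding c(3) unfolding L_def c_def .
qed

lemma H_le:
  assumes \<nu>: "0 \<le> \<nu>" "\<nu> \<le> 1" and fin: "hoelder_const B \<psi> f \<nu> < \<infinity>"
  shows "H k \<le> 8 * enn2real (hoelder_const B \<psi> f \<nu>) * D powr (\<nu> - 1) * real k powr (3 * (1 - \<nu>) / 2)
    + sqrt (2 * (\<Sum>i<k. (real (Suc i))\<^sup>2 * (\<delta> i)\<^sup>2)) / D"
proof (induction k)
  case 0
  show ?case
    by (simp add: init)
next
  case (Suc k)
  define L where "L = enn2real (hoelder_const B \<psi> f \<nu>)"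
  define q where "q = 3 * (1 - \<nu>) / 2"
  \<comment> \<open>Since \<open>0 powr 0 = 0\<close>, b starts at 0 even for \<nu> = 1; in that
    case it jumps to 8 L in the first step and then stays constant.\<close>
  define b where "b = (\<lambda>k. 8 * L * D powr (\<nu> - 1) * real k powr q)"
  define N where "N = (\<lambda>k. sqrt (2 * (\<Sum>i<k. (real (Suc i))\<^sup>2 * (\<delta> i)\<^sup>2)) / D)"
  have L: "0 \<le> L"
    by (simp add: L_def)
  have sum_nonneg': "0 \<le> (\<Sum>i<k. (real (Suc i))\<^sup>2 * (\<delta> i)\<^sup>2)" for k
    by (intro sum_nonneg) auto
  have N_sq: "D\<^sup>2 * (N k)\<^sup>2 = 2 * (\<Sum>i<k. (real (Suc i))\<^sup>2 * (\<delta> i)\<^sup>2)" for k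
    using D_pos sum_nonneg' by (simp add: N_def power_divide)
  have "H (Suc k) \<le> b (Suc k) + N (Suc k)"
  proof (rule implicit_sqrt_step)
    show "H k \<le> b k + N k"
      using Suc by (simp add: b_def N_def L_def q_def)
    show "0 \<le> N k" "N k \<le> N (Suc k)"
      using D_pos sum_nonneg' by (auto simp: N_def intro!: divide_right_mono)
    show "0 \<le> b (Suc k)"
      using L by (simp add: b_def)
    \<comment> \<open>This case lets the quadratic term be halved: in one half H_{k+1} is lowered to
      b_{k+1} to absorb the Hoelder term, and the other half absorbs the noise by completing the
      square.\<close>
    assume big: "b (Suc k) < H (Suc k)"
    define h where "h = H (Suc k)"
    have h: "0 < h"
      using big \<open>0 \<le> b (Suc k)\<close> by (simp add: h_def)
    define n where "n = real (Suc k)"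
    define \<rho> where "\<rho> = r k / D"
    have \<rho>: "0 \<le> \<rho>" "r k = \<rho> * D"
      using D_pos by (auto simp: \<rho>_def)
    have "n * (2 / (n + 1)) powr \<nu> * \<rho> powr (1 + \<nu>) - 2 * n powr q * \<rho>\<^sup>2 \<le> 8 * (n powr q - (n - 1) powr q)"
      unfolding q_def using \<nu> \<rho> by (intro hoelder_increment_bound) (auto simp: n_def)
    then have "L * D powr (1 + \<nu>) * (n * (2 / (n + 1)) powr \<nu> * \<rho> powr (1 + \<nu>) - 2 * n powr q * \<rho>\<^sup>2)
        \<le> L * D powr (1 + \<nu>) * (8 * (n powr q - (n - 1) powr q))"
      using L by (intro mult_left_mono) auto
    moreover have D: "D powr (1 + \<nu>) = D\<^sup>2 * D powr (\<nu> - 1)"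
      using D_pos by (simp add: powr_add powr_diff power2_eq_square)
    have "D\<^sup>2 * (b (Suc k) - b k) = L * D powr (1 + \<nu>) * (8 * (n powr q - (n - 1) powr q))"
      unfolding D b_def n_def by (simp add: algebra_simps)
    moreover have "L * (n * (2 / (n + 1)) powr \<nu> * r k powr (1 + \<nu>)) - b (Suc k) * (r k)\<^sup>2 / 4
        = L * D powr (1 + \<nu>) * (n * (2 / (n + 1)) powr \<nu> * \<rho> powr (1 + \<nu>) - 2 * n powr q * \<rho>\<^sup>2)"
    proof -
      have "r k powr (1 + \<nu>) = \<rho> powr (1 + \<nu>) * D powr (1 + \<nu>)"
        unfolding \<rho>(2) using \<rho>(1) D_pos by (simp add: powr_mult)
      moreover have "b (Suc k) * (r k)\<^sup>2 / 4 = L * D powr (1 + \<nu>) * (2 * n powr q * \<rho>\<^sup>2)"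
        unfolding D b_def n_def \<rho>(2) by (simp add: power_mult_distrib)
      ultimately show ?thesis
        by (simp add: algebra_simps)
    qed
    ultimately have 1: "L * (n * (2 / (n + 1)) powr \<nu> * r k powr (1 + \<nu>)) - b (Suc k) * (r k)\<^sup>2 / 4
        \<le> D\<^sup>2 * (b (Suc k) - b k)"
      by simp
    have 2: "b (Suc k) * (r k)\<^sup>2 / 4 \<le> h * (r k)\<^sup>2 / 4"
      using big by (simp add: h_def mult_right_mono)
    have 3: "n * \<delta> k * r k - h * (r k)\<^sup>2 / 4 \<le> (n * \<delta> k)\<^sup>2 / h"
    proof -
      have "0 \<le> (n * \<delta> k - h * r k / 2)\<^sup>2 / h"
        using h by simp
      also have "\<dots> = (n * \<delta> k)\<^sup>2 / h - n * \<delta> k * r k + h * (r k)\<^sup>2 / 4"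
        using h by (simp add: power2_eq_square field_simps)
      finally show ?thesis
        by simp
    qed
    have "cum_weight (Suc k) * \<beta> k - h * (r k)\<^sup>2 / 2 \<le> D\<^sup>2 * (b (Suc k) - b k) + (n * \<delta> k)\<^sup>2 / h"
      using weighted_\<beta>_le[OF \<nu> fin, of k] 1 2 3 unfolding n_def L_def by linarith
    \<comment> \<open>Needed because the implicit equation takes a positive part.\<close>
    moreover have "0 \<le> D\<^sup>2 * (b (Suc k) - b k) + (n * \<delta> k)\<^sup>2 / h"
    proof -
      have "b k \<le> b (Suc k)"
        using L \<nu> by (auto simp: b_def q_def intro!: mult_left_mono powr_mono2)
      then show ?thesis
        using h by simp
    qed
    ultimately have "D\<^sup>2 * (h - H k) \<le> D\<^sup>2 * (b (Suc k) - b k) + (n * \<delta> k)\<^sup>2 / h"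
      unfolding h_def H_increment_implicit by simp
    moreover have "(n * \<delta> k)\<^sup>2 / h = D\<^sup>2 * (((N (Suc k))\<^sup>2 - (N k)\<^sup>2) / (2 * h))"
    proof -
      have "D\<^sup>2 * ((N (Suc k))\<^sup>2 - (N k)\<^sup>2) = 2 * (n * \<delta> k)\<^sup>2"
        unfolding right_diff_distrib N_sq by (simp add: n_def power_mult_distrib)
      then have "D\<^sup>2 * (((N (Suc k))\<^sup>2 - (N k)\<^sup>2) / (2 * h)) = 2 * (n * \<delta> k)\<^sup>2 / (2 * h)"
        by (metis times_divide_eq_right)
      then show ?thesis
        by simp
    qed
    ultimately have "D\<^sup>2 * (h - H k) \<le> D\<^sup>2 * ((b (Suc k) - b k) + ((N (Suc k))\<^sup>2 - (N k)\<^sup>2) / (2 * h))"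
      by (simp add: distrib_left)
    then show "H (Suc k) - H k \<le> (b (Suc k) - b k) + ((N (Suc k))\<^sup>2 - (N k)\<^sup>2) / (2 * H (Suc k))"
      using D_pos by (simp add: h_def)
  qed
  then show ?case
    by (simp add: b_def N_def L_def q_def)
qed

end

subsection \<open>Oracle errors at random query points\<close>

lemma measurable_history_algebra:
  assumes "X \<in> measurable M S" "Z \<in> measurable (vimage_algebra (space M) X S) T"
  shows "Z \<in> measurable M T"
proof -
  have "(\<lambda>\<omega>. \<omega>) \<in> measurable M (vimage_algebra (space M) X S)"
    using assms(1) by (intro measurable_vimage_algebra2) auto
  from measurable_compose[OF this assms(2)] show ?thesis .
qed

text \<open>Preimages under a map measurable for the algebra generated by X are preimages under X,
  so independence of Y carries over; the product law is then checked on rectangles. It allows Fubini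
  at random query points.\<close>

lemma indep_rv_distr_pair:
  assumes M: "prob_space M" and indep: "indep_rv M S X P Y"
    and Z: "Z \<in> measurable (vimage_algebra (space M) X S) T"
  shows "distr M (T \<Otimes>\<^sub>M P) (\<lambda>\<omega>. (Z \<omega>, Y \<omega>)) = distr M T Z \<Otimes>\<^sub>M distr M P Y"
proof -
  interpret prob_space M by fact
  have X: "X \<in> measurable M S" and Y [measurable]: "Y \<in> measurable M P"
    using indep by (auto simp: indep_rv_def)
  have Z' [measurable]: "Z \<in> measurable M T"
    using X Z by (rule measurable_history_algebra)
  interpret Z: prob_space "distr M T Z"
    by (rule prob_space_distr) fact
  interpret Y: prob_space "distr M P Y"
    by (rule prob_space_distr) fact
  show ?thesis
  proof (rule pair_measure_eqI [symmetric])
    show "sigma_finite_measure (distr M T Z)" "sigma_finite_measure (distr M P Y)"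
      by unfold_locales
    show "sets (distr M T Z \<Otimes>\<^sub>M distr M P Y) = sets (distr M (T \<Otimes>\<^sub>M P) (\<lambda>\<omega>. (Z \<omega>, Y \<omega>)))"
      by (simp cong: sets_pair_measure_cong)
    fix A C assume "A \<in> sets (distr M T Z)" "C \<in> sets (distr M P Y)"
    then have A: "A \<in> sets T" and C: "C \<in> sets P"
      by auto
    have "Z -` A \<inter> space M \<in> sets (vimage_algebra (space M) X S)"
      using measurable_sets[OF Z A] by simp
    then have "Z -` A \<inter> space M \<in> {X -` A \<inter> space M | A. A \<in> sets S}"
      using X by (subst (asm) sets_vimage_algebra2) (auto dest: measurable_space)
    moreover have "Y -` C \<inter> space M \<in> {Y -` A \<inter> space M | A. A \<in> sets P}"
      using C by blast
    moreover have "indep_set {X -` A \<inter> space M | A. A \<in> sets S} {Y -` A \<inter> space M | A. A \<in> sets P}"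
      using indep by (simp add: indep_rv_def)
    ultimately have "prob ((Z -` A \<inter> space M) \<inter> (Y -` C \<inter> space M))
        = prob (Z -` A \<inter> space M) * prob (Y -` C \<inter> space M)"
      by (intro indep_setD)
    moreover have "(\<lambda>\<omega>. (Z \<omega>, Y \<omega>)) -` (A \<times> C) \<inter> space M = (Z -` A \<inter> space M) \<inter> (Y -` C \<inter> space M)"
      by auto
    ultimately show "emeasure (distr M T Z) A * emeasure (distr M P Y) C
        = emeasure (distr M (T \<Otimes>\<^sub>M P) (\<lambda>\<omega>. (Z \<omega>, Y \<omega>))) (A \<times> C)"
      using A C by (simp add: emeasure_distr emeasure_eq_measure ennreal_mult)
  qed
qed

text \<open>Jensen's inequality for the square root, in the form that the variance of the square
  root is nonnegative.\<close>

lemma (in prob_space) expectation_sqrt_le: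
  assumes int: "integrable M V" and nonneg: "\<And>\<omega>. \<omega> \<in> space M \<Longrightarrow> 0 \<le> V \<omega>"
  shows "integrable M (\<lambda>\<omega>. sqrt (V \<omega>))" "expectation (\<lambda>\<omega>. sqrt (V \<omega>)) \<le> sqrt (expectation V)"
proof -
  have [measurable]: "V \<in> borel_measurable M"
    using int by simp
  have bound: "sqrt t \<le> 1 + t" if "0 \<le> t" for t :: real
  proof (rule real_le_lsqrt)
    show "t \<le> (1 + t)\<^sup>2"
      using that by (simp add: power2_eq_square algebra_simps)
  qed (use that in auto)
  show int': "integrable M (\<lambda>\<omega>. sqrt (V \<omega>))"
  proof (rule Bochner_Integration.integrable_bound)
    show "integrable M (\<lambda>\<omega>. 1 + V \<omega>)"
      using int by simp
    show "AE \<omega> in M. norm (sqrt (V \<omega>)) \<le> norm (1 + V \<omega>)"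
    proof (rule AE_I2)
      fix \<omega> assume "\<omega> \<in> space M"
      then show "norm (sqrt (V \<omega>)) \<le> norm (1 + V \<omega>)"
        using bound[OF nonneg, of \<omega>] nonneg[of \<omega>] by simp
    qed
  qed simp
  have sq: "integrable M (\<lambda>\<omega>. (sqrt (V \<omega>))\<^sup>2)"
    by (rule Bochner_Integration.integrable_cong[THEN iffD1, OF refl _ int]) (simp add: nonneg)
  have "0 \<le> variance (\<lambda>\<omega>. sqrt (V \<omega>))"
    by (rule variance_positive)
  moreover have "expectation (\<lambda>\<omega>. (sqrt (V \<omega>))\<^sup>2) = expectation V"
    by (rule Bochner_Integration.integral_cong) (simp_all add: nonneg)
  ultimately have "(expectation (\<lambda>\<omega>. sqrt (V \<omega>)))\<^sup>2 \<le> expectation V"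
    using variance_eq[OF int' sq] by simp
  then show "expectation (\<lambda>\<omega>. sqrt (V \<omega>)) \<le> sqrt (expectation V)"
    by (rule real_le_rsqrt)
qed

text \<open>The subgradient selection f'(x) that belongs to an unbiased oracle.\<close>

definition mean_grad :: "'e measure \<Rightarrow> (real^'n \<Rightarrow> 'e \<Rightarrow> real^'n) \<Rightarrow> real^'n \<Rightarrow> real^'n" where
  "mean_grad P g z = (\<integral>e. g z e \<partial>P)"

text \<open>With \<sigma> real, the equation for its square also says that the supremum of the
  variances is finite.\<close>

locale stochastic_oracle = spd_matrix B for B :: "real^'n^'n" +
  fixes \<psi> f :: "real^'n \<Rightarrow> ereal" and P :: "'e measure" and g :: "real^'n \<Rightarrow> 'e \<Rightarrow> real^'n" and \<sigma> :: real
    and M :: "'w measure"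
  assumes unbiased: "unbiased_oracle \<psi> f P g"
    and variance: "ennreal (\<sigma>\<^sup>2) = oracle_variance B \<psi> P g"
    and M: "prob_space M"
begin

sublocale M: prob_space M
  by (rule M)

sublocale P: prob_space P
  using unbiased by (simp add: unbiased_oracle_def)

abbreviation query_space :: "(real^'n) measure" where
  "query_space \<equiv> restrict_space borel (eff_dom \<psi>)"

lemma g_measurable [measurable]: "(\<lambda>(z, e). g z e) \<in> borel_measurable (query_space \<Otimes>\<^sub>M P)"
  using unbiased by (simp add: unbiased_oracle_def)

lemma g_integrable: "z \<in> eff_dom \<psi> \<Longrightarrow> integrable P (g z)"
  using unbiased by (simp add: unbiased_oracle_def)

lemma mean_grad_measurable [measurable]: "mean_grad P g \<in> borel_measurable query_space"
  unfolding mean_grad_def [abs_def] by (rule P.borel_measurable_lebesgue_integral) (rule g_measurable)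

lemma dual_norm_measurable [measurable]: "dual_norm_of B \<in> borel_measurable borel"
proof -
  have [measurable]: "(\<lambda>s. matrix_inv B *v s) \<in> borel_measurable borel"
    by (intro borel_measurable_continuous_onI linear_continuous_on matrix_vector_mul_bounded_linear)
  show ?thesis
    unfolding dual_norm_of_def by measurable
qed

definition oracle_error :: "(real^'n) \<times> 'e \<Rightarrow> real^'n" where
  "oracle_error = (\<lambda>(z, e). g z e - mean_grad P g z)"

lemma oracle_error_measurable [measurable]: "oracle_error \<in> borel_measurable (query_space \<Otimes>\<^sub>M P)"
  unfolding oracle_error_def by measurable

lemma oracle_error_variance:
  assumes "z \<in> eff_dom \<psi>"
  shows "(\<integral>\<^sup>+e. ennreal ((dual_norm_of B (oracle_error (z, e)))\<^sup>2) \<partial>P) \<le> ennreal (\<sigma>\<^sup>2)"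
  unfolding variance oracle_variance_def oracle_error_def mean_grad_def prod.case
  using assms by (rule SUP_upper)

text \<open>Query point and fresh sample have a product law, and the inner integral over the sample
  is at most \<sigma>^2 at each feasible point. Computing with nonnegative integrals first makes
  integrability a consequence.\<close>

lemma oracle_error_square:
  assumes indep: "indep_rv M S X P Y" and Y: "distr M P Y = P"
    and Z: "Z \<in> measurable (vimage_algebra (space M) X S) query_space"
  shows "integrable M (\<lambda>\<omega>. (dual_norm_of B (oracle_error (Z \<omega>, Y \<omega>)))\<^sup>2)"
    and "M.expectation (\<lambda>\<omega>. (dual_norm_of B (oracle_error (Z \<omega>, Y \<omega>)))\<^sup>2) \<le> \<sigma>\<^sup>2"
proof -
  have X: "X \<in> measurable M S" and [measurable]: "Y \<in> measurable M P"
    using indep by (auto simp: indep_rv_def)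
  have Z' [measurable]: "Z \<in> measurable M query_space"
    using X Z by (rule measurable_history_algebra)
  interpret Z: prob_space "distr M query_space Z"
    by (rule M.prob_space_distr) fact
  let ?h = "\<lambda>p. ennreal ((dual_norm_of B (oracle_error p))\<^sup>2)"
  have "(\<integral>\<^sup>+\<omega>. ?h (Z \<omega>, Y \<omega>) \<partial>M) = (\<integral>\<^sup>+p. ?h p \<partial>distr M (query_space \<Otimes>\<^sub>M P) (\<lambda>\<omega>. (Z \<omega>, Y \<omega>)))"
    by (subst nn_integral_distr) auto
  also have "\<dots> = (\<integral>\<^sup>+p. ?h p \<partial>(distr M query_space Z \<Otimes>\<^sub>M P))"
    by (simp add: indep_rv_distr_pair[OF M indep Z] Y)
  also have "\<dots> = (\<integral>\<^sup>+z. \<integral>\<^sup>+e. ?h (z, e) \<partial>P \<partial>distr M query_space Z)"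
    by (subst P.nn_integral_fst) (auto cong: measurable_cong_sets)
  also have "\<dots> \<le> (\<integral>\<^sup>+z. ennreal (\<sigma>\<^sup>2) \<partial>distr M query_space Z)"
    by (intro nn_integral_mono oracle_error_variance) (simp add: space_restrict_space)
  also have "\<dots> = ennreal (\<sigma>\<^sup>2)"
    using Z.emeasure_space_1 by simp
  finally have le: "(\<integral>\<^sup>+\<omega>. ?h (Z \<omega>, Y \<omega>) \<partial>M) \<le> ennreal (\<sigma>\<^sup>2)" .
  then have "(\<integral>\<^sup>+\<omega>. ?h (Z \<omega>, Y \<omega>) \<partial>M) < \<infinity>"
    using ennreal_less_top le_less_trans by fastforce
  then show int: "integrable M (\<lambda>\<omega>. (dual_norm_of B (oracle_error (Z \<omega>, Y \<omega>)))\<^sup>2)"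
    by (intro integrableI_nonneg) auto
  show "M.expectation (\<lambda>\<omega>. (dual_norm_of B (oracle_error (Z \<omega>, Y \<omega>)))\<^sup>2) \<le> \<sigma>\<^sup>2"
    using le nn_integral_eq_integral[OF int] by (simp add: ennreal_le_iff)
qed

lemma oracle_error_norm_square_integrable:
  assumes "indep_rv M S X P Y" "distr M P Y = P"
    and Z: "Z \<in> measurable (vimage_algebra (space M) X S) query_space"
  shows "integrable M (\<lambda>\<omega>. (norm (oracle_error (Z \<omega>, Y \<omega>)))\<^sup>2)"
proof -
  have X: "X \<in> measurable M S" and [measurable]: "Y \<in> measurable M P"
    using assms by (auto simp: indep_rv_def)
  have Z' [measurable]: "Z \<in> measurable M query_space"
    using X Z by (rule measurable_history_algebra)
  obtain K where K: "0 < K" "\<And>s. norm s \<le> K * dual_norm_of B s"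
    using norm_le_dual_norm_of by blast
  have bound: "(norm s)\<^sup>2 \<le> K\<^sup>2 * (dual_norm_of B s)\<^sup>2" for s
    using power_mono[OF K(2)[of s] norm_ge_zero, of 2] by (simp add: power_mult_distrib)
  show ?thesis
  proof (rule Bochner_Integration.integrable_bound)
    show "integrable M (\<lambda>\<omega>. K\<^sup>2 * (dual_norm_of B (oracle_error (Z \<omega>, Y \<omega>)))\<^sup>2)"
      using oracle_error_square(1)[OF assms] by simp
    show "AE \<omega> in M. norm ((norm (oracle_error (Z \<omega>, Y \<omega>)))\<^sup>2)
        \<le> norm (K\<^sup>2 * (dual_norm_of B (oracle_error (Z \<omega>, Y \<omega>)))\<^sup>2)"
      by (rule AE_I2) (simp add: bound)
  qed simp
qed

text \<open>Given the past, the error has mean zero. Fubini for the product law takes the place of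
  conditional expectations; square integrability of both factors makes their inner product
  integrable.\<close>

lemma oracle_error_orthogonal:
  assumes indep: "indep_rv M S X P Y" and Y: "distr M P Y = P"
    and Z: "Z \<in> measurable (vimage_algebra (space M) X S) query_space"
    and W: "W \<in> borel_measurable (vimage_algebra (space M) X S)"
    and W_int: "integrable M (\<lambda>\<omega>. (norm (W \<omega>))\<^sup>2)"
  shows "integrable M (\<lambda>\<omega>. W \<omega> \<bullet> oracle_error (Z \<omega>, Y \<omega>))"
    and "M.expectation (\<lambda>\<omega>. W \<omega> \<bullet> oracle_error (Z \<omega>, Y \<omega>)) = 0"
proof -
  have X: "X \<in> measurable M S" and [measurable]: "Y \<in> measurable M P"
    using indep by (auto simp: indep_rv_def)
  have Z' [measurable]: "Z \<in> measurable M query_space"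
    using X Z by (rule measurable_history_algebra)
  have W' [measurable]: "W \<in> borel_measurable M"
    using X W by (rule measurable_history_algebra)
  have bound: "\<bar>w \<bullet> s\<bar> \<le> (norm w)\<^sup>2 + (norm s)\<^sup>2" for w s :: "real^'n"
  proof -
    have "2 * (norm w * norm s) \<le> (norm w)\<^sup>2 + (norm s)\<^sup>2"
      using sum_squares_bound[of "norm w" "norm s"] by simp
    moreover have "0 \<le> norm w * norm s"
      by simp
    ultimately show ?thesis
      using Cauchy_Schwarz_ineq2[of w s] by linarith
  qed
  show int: "integrable M (\<lambda>\<omega>. W \<omega> \<bullet> oracle_error (Z \<omega>, Y \<omega>))"
  proof (rule Bochner_Integration.integrable_bound)
    show "integrable M (\<lambda>\<omega>. (norm (W \<omega>))\<^sup>2 + (norm (oracle_error (Z \<omega>, Y \<omega>)))\<^sup>2)"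
      using W_int oracle_error_norm_square_integrable[OF indep Y Z] by (rule Bochner_Integration.integrable_add)
    show "AE \<omega> in M. norm (W \<omega> \<bullet> oracle_error (Z \<omega>, Y \<omega>))
        \<le> norm ((norm (W \<omega>))\<^sup>2 + (norm (oracle_error (Z \<omega>, Y \<omega>)))\<^sup>2)"
      unfolding real_norm_def by (rule AE_I2) (rule order_trans [OF bound abs_ge_self])
  qed simp
  let ?T = "query_space \<Otimes>\<^sub>M (borel :: (real^'n) measure)"
  \<comment> \<open>Query point and test vector are paired so that the inner integral over the
    sample treats both as constants.\<close>
  define ZW where "ZW = (\<lambda>\<omega>. (Z \<omega>, W \<omega>))"
  have ZW: "ZW \<in> measurable (vimage_algebra (space M) X S) ?T"
    unfolding ZW_def using Z W by measurable
  have ZW' [measurable]: "ZW \<in> measurable M ?T"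
    using X ZW by (rule measurable_history_algebra)
  interpret ZW: prob_space "distr M ?T ZW"
    by (rule M.prob_space_distr) fact
  interpret pair_sigma_finite "distr M ?T ZW" P
    by unfold_locales
  define h where "h = (\<lambda>p. snd (fst p) \<bullet> oracle_error (fst (fst p), snd p))"
  have h [measurable]: "h \<in> borel_measurable (?T \<Otimes>\<^sub>M P)"
    unfolding h_def by measurable
  have pair: "distr M (?T \<Otimes>\<^sub>M P) (\<lambda>\<omega>. (ZW \<omega>, Y \<omega>)) = distr M ?T ZW \<Otimes>\<^sub>M P"
    by (simp add: indep_rv_distr_pair[OF M indep ZW] Y)
  have eq: "(\<lambda>\<omega>. W \<omega> \<bullet> oracle_error (Z \<omega>, Y \<omega>)) = (\<lambda>\<omega>. h (ZW \<omega>, Y \<omega>))"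
    by (simp add: h_def ZW_def)
  have int': "integrable (distr M ?T ZW \<Otimes>\<^sub>M P) h"
    unfolding pair [symmetric] using int unfolding eq by (subst integrable_distr_eq) auto
  have "M.expectation (\<lambda>\<omega>. h (ZW \<omega>, Y \<omega>)) = (\<integral>p. h p \<partial>distr M (?T \<Otimes>\<^sub>M P) (\<lambda>\<omega>. (ZW \<omega>, Y \<omega>)))"
    by (subst integral_distr) auto
  also have "\<dots> = (\<integral>q. \<integral>e. h (q, e) \<partial>P \<partial>distr M ?T ZW)"
    unfolding pair using integral_fst'[OF int'] by simp
  also have "\<dots> = (\<integral>q. 0 \<partial>distr M ?T ZW)"
  proof (rule Bochner_Integration.integral_cong)
    fix q assume "q \<in> space (distr M ?T ZW)"
    then have q: "fst q \<in> eff_dom \<psi>"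
      by (auto simp: space_pair_measure space_restrict_space)
    have "(\<integral>e. h (q, e) \<partial>P) = (\<integral>e. snd q \<bullet> (g (fst q) e - mean_grad P g (fst q)) \<partial>P)"
      by (simp add: h_def oracle_error_def split_beta)
    also have "\<dots> = snd q \<bullet> (\<integral>e. g (fst q) e - mean_grad P g (fst q) \<partial>P)"
      using g_integrable[OF q] by (intro integral_inner_right) auto
    also have "(\<integral>e. g (fst q) e - mean_grad P g (fst q) \<partial>P) = 0"
      using g_integrable[OF q] by (simp add: mean_grad_def P.prob_space)
    finally show "(\<integral>e. h (q, e) \<partial>P) = 0"
      by simp
  qed simp
  finally show "M.expectation (\<lambda>\<omega>. W \<omega> \<bullet> oracle_error (Z \<omega>, Y \<omega>)) = 0"
    by (simp add: eq)
qed

end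

subsection \<open>Expectations along the random trajectory\<close>

locale stochastic_usfgm =
  stochastic_oracle B \<psi> f P g \<sigma> M + composite_problem B \<psi> f "mean_grad P g" D
  for B :: "real^'n^'n" and \<psi> f :: "real^'n \<Rightarrow> ereal" and P :: "'e measure"
    and g :: "real^'n \<Rightarrow> 'e \<Rightarrow> real^'n" and \<sigma> :: real and M :: "'w measure" and D :: real +
  fixes \<xi>y \<xi>x :: "nat \<Rightarrow> 'w \<Rightarrow> 'e" and x v y :: "nat \<Rightarrow> 'w \<Rightarrow> real^'n" and H :: "nat \<Rightarrow> 'w \<Rightarrow> real"
    and x0 :: "real^'n"
  assumes f_closed_convex: "closed_convex_fun f"
    and fresh: "fresh_copies M P v \<xi>y \<xi>x"
    and run: "\<omega> \<in> space M \<Longrightarrow>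
      usfgm_run B \<psi> D x0 (\<lambda>k. g (y k \<omega>) (\<xi>y k \<omega>)) (\<lambda>k. g (x k \<omega>) (\<xi>x k \<omega>))
        (\<lambda>k. x k \<omega>) (\<lambda>k. v k \<omega>) (\<lambda>k. y k \<omega>) (\<lambda>k. H k \<omega>)"
begin

section \<open>Measurability of the trajectory with respect to its history\<close>

lemma path:
  assumes "\<omega> \<in> space M"
  shows "usfgm B \<psi> f (mean_grad P g) D x0 (\<lambda>k. g (y k \<omega>) (\<xi>y k \<omega>)) (\<lambda>k. g (x k \<omega>) (\<xi>x k \<omega>))
    (\<lambda>k. x k \<omega>) (\<lambda>k. v k \<omega>) (\<lambda>k. y k \<omega>) (\<lambda>k. H k \<omega>)"
  by (intro usfgm.intro usfgm_axioms.intro composite_problem_axioms run assms)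

lemma points_dom:
  assumes "\<omega> \<in> space M"
  shows "v k \<omega> \<in> eff_dom \<psi>" "x k \<omega> \<in> eff_dom \<psi>" "y k \<omega> \<in> eff_dom \<psi>"
  using usfgm.v_dom[OF path] usfgm.x_dom[OF path] usfgm.y_dom[OF path] assms by auto

text \<open>The information available to the method: indices (k, k, k) just before the query at y_k,
  and (k + 1, k + 1, k) just before the query at x_{k+1}.\<close>

abbreviation hist_algebra :: "nat \<Rightarrow> nat \<Rightarrow> nat \<Rightarrow> 'w measure" where
  "hist_algebra m p q \<equiv> vimage_algebra (space M) (history v \<xi>y \<xi>x m p q) (history_space P m p q)"

abbreviation history_measurable :: "nat \<Rightarrow> nat \<Rightarrow> nat \<Rightarrow> bool" where
  "history_measurable m p q \<equiv> history v \<xi>y \<xi>x m p q \<in> measurable M (history_space P m p q)"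

lemma indep_y: "indep_rv M (history_space P k k k) (history v \<xi>y \<xi>x k k k) P (\<xi>y k)"
    "distr M P (\<xi>y k) = P"
  and indep_x: "indep_rv M (history_space P (Suc k) (Suc k) k) (history v \<xi>y \<xi>x (Suc k) (Suc k) k) P (\<xi>x (Suc k))"
    "distr M P (\<xi>x (Suc k)) = P"
  using fresh by (auto simp: fresh_copies_def)

lemma history_y: "history_measurable k k k"
  and history_x: "history_measurable (Suc k) (Suc k) k"
  using indep_y(1)[of k] indep_x(1)[of k] by (auto simp: indep_rv_def)

lemma \<xi>_measurable [measurable]: "\<xi>y k \<in> measurable M P" "\<xi>x (Suc k) \<in> measurable M P"
  using indep_y(1)[of k] indep_x(1)[of k] by (auto simp: indep_rv_def)

lemma history_measurable_hist:
  assumes "history_measurable m p q"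
  shows "history v \<xi>y \<xi>x m p q \<in> measurable (hist_algebra m p q) (history_space P m p q)"
  using assms by (intro measurable_vimage_algebra1) (auto dest: measurable_space)

lemma v_hist:
  assumes "history_measurable m p q" "i \<le> m"
  shows "v i \<in> borel_measurable (hist_algebra m p q)"
proof -
  have "(\<lambda>h. fst h i) \<in> measurable (history_space P m p q) (borel :: (real^'n) measure)"
    unfolding history_space_def using assms(2)
    by (intro measurable_compose[OF measurable_fst] measurable_component_singleton) auto
  from measurable_compose[OF history_measurable_hist[OF assms(1)] this] show ?thesis
    using assms(2) by (simp add: history_def)
qed

lemma \<xi>y_hist:
  assumes "history_measurable m p q" "i < p"
  shows "\<xi>y i \<in> measurable (hist_algebra m p q) P"
proof -
  have "(\<lambda>h. fst (snd h) i) \<in> measurable (history_space P m p q) P"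
    unfolding history_space_def using assms(2)
    by (intro measurable_compose[OF measurable_snd] measurable_compose[OF measurable_fst]
        measurable_component_singleton) auto
  from measurable_compose[OF history_measurable_hist[OF assms(1)] this] show ?thesis
    using assms(2) by (simp add: history_def)
qed

text \<open>Each x_i is a fixed linear combination of x_0 and v_1, ..., v_i. The recursion holds
  only on \<open>space M\<close>, hence the transfer by \<open>measurable_cong\<close>.\<close>

lemma x_hist:
  assumes hist: "history_measurable m p q" and "i \<le> m"
  shows "x i \<in> borel_measurable (hist_algebra m p q)"
  using assms(2)
proof (induction i)
  case 0
  have "(\<lambda>\<omega>. x0) \<in> borel_measurable (hist_algebra m p q)"
    by simp
  then show ?case
    by (rule measurable_cong[THEN iffD1, rotated]) (simp add: usfgm.init[OF path])
next
  case (Suc i)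
  have [measurable]: "x i \<in> borel_measurable (hist_algebra m p q)" "v (Suc i) \<in> borel_measurable (hist_algebra m p q)"
    using Suc v_hist[OF hist] by auto
  have "(\<lambda>\<omega>. (cum_weight i / cum_weight (Suc i)) *\<^sub>R x i \<omega> + (weight (Suc i) / cum_weight (Suc i)) *\<^sub>R v (Suc i) \<omega>)
      \<in> borel_measurable (hist_algebra m p q)"
    by measurable
  then show ?case
    by (rule measurable_cong[THEN iffD1, rotated]) (simp only: space_vimage_algebra usfgm.x_Suc[OF path])
qed

lemma y_hist:
  assumes hist: "history_measurable m p q" and "i \<le> m"
  shows "y i \<in> borel_measurable (hist_algebra m p q)"
proof -
  have [measurable]: "x i \<in> borel_measurable (hist_algebra m p q)" "v i \<in> borel_measurable (hist_algebra m p q)"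
    using assms v_hist x_hist by auto
  have "(\<lambda>\<omega>. (cum_weight i / cum_weight (Suc i)) *\<^sub>R x i \<omega> + (weight (Suc i) / cum_weight (Suc i)) *\<^sub>R v i \<omega>)
      \<in> borel_measurable (hist_algebra m p q)"
    by measurable
  then show ?thesis
    by (rule measurable_cong[THEN iffD1, rotated]) (simp only: space_vimage_algebra usfgm.y_eq[OF path])
qed

lemma x_query:
  "history_measurable m p q \<Longrightarrow> i \<le> m \<Longrightarrow> x i \<in> measurable (hist_algebra m p q) query_space"
  using points_dom by (intro measurable_restrict_space2 x_hist) auto

lemma y_query:
  "history_measurable m p q \<Longrightarrow> i \<le> m \<Longrightarrow> y i \<in> measurable (hist_algebra m p q) query_space"
  using points_dom by (intro measurable_restrict_space2 y_hist) auto

lemma points_measurable [measurable]: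
  "v k \<in> borel_measurable M" "x k \<in> borel_measurable M" "y k \<in> borel_measurable M"
  "x k \<in> measurable M query_space" "y k \<in> measurable M query_space"
  using v_hist[OF history_y order_refl] x_hist[OF history_y order_refl] y_hist[OF history_y order_refl]
    x_query[OF history_y order_refl] y_query[OF history_y order_refl]
  by (blast intro: measurable_history_algebra[OF history_y])+

section \<open>Oracle errors along the trajectory\<close>

definition error_y :: "nat \<Rightarrow> 'w \<Rightarrow> real^'n" where
  "error_y k \<omega> = oracle_error (y k \<omega>, \<xi>y k \<omega>)"

definition error_x :: "nat \<Rightarrow> 'w \<Rightarrow> real^'n" where
  "error_x k \<omega> = oracle_error (x (Suc k) \<omega>, \<xi>x (Suc k) \<omega>)"

lemma error_measurable [measurable]:
  "error_y k \<in> borel_measurable M" "error_x k \<in> borel_measurable M"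
  unfolding error_y_def error_x_def by measurable

text \<open>The sample used at y_k already belongs to the history when x_{k+1} is queried; this
  makes the two errors of a step orthogonal.\<close>

lemma error_y_hist: "error_y k \<in> borel_measurable (hist_algebra (Suc k) (Suc k) k)"
proof -
  have [measurable]: "y k \<in> measurable (hist_algebra (Suc k) (Suc k) k) query_space"
      "\<xi>y k \<in> measurable (hist_algebra (Suc k) (Suc k) k) P"
    using y_query[OF history_x] \<xi>y_hist[OF history_x] by auto
  show ?thesis
    unfolding error_y_def by measurable
qed

lemma H_measurable [measurable]: "H k \<in> borel_measurable M"
proof (induction k)
  case 0
  have "(\<lambda>\<omega>. 0) \<in> borel_measurable M"
    by simp
  then show ?case
    by (rule measurable_cong[THEN iffD1, rotated]) (simp add: usfgm.init[OF path])
next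
  case (Suc k)
  note [measurable] = Suc
  have [measurable]: "(\<lambda>\<omega>. g (y k \<omega>) (\<xi>y k \<omega>)) \<in> borel_measurable M"
    using measurable_compose[OF measurable_Pair[OF points_measurable(5) \<xi>_measurable(1)] g_measurable] by simp
  have [measurable]: "(\<lambda>\<omega>. g (x (Suc k) \<omega>) (\<xi>x (Suc k) \<omega>)) \<in> borel_measurable M"
    using measurable_compose[OF measurable_Pair[OF points_measurable(4) \<xi>_measurable(2)] g_measurable] by simp
  have [measurable]: "(\<lambda>s. B *v s) \<in> borel_measurable borel"
    by (intro borel_measurable_continuous_onI linear_continuous_on matrix_vector_mul_bounded_linear)
  have [measurable]: "norm_of B \<in> borel_measurable borel"
    unfolding norm_of_def by measurable
  have "(\<lambda>\<omega>. H k \<omega> + max (cum_weight (Suc k)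
        * ((g (x (Suc k) \<omega>) (\<xi>x (Suc k) \<omega>) - g (y k \<omega>) (\<xi>y k \<omega>)) \<bullet> (x (Suc k) \<omega> - y k \<omega>))
        - H k \<omega> * (norm_of B (v (Suc k) \<omega> - v k \<omega>))\<^sup>2 / 2) 0
      / (D\<^sup>2 + (norm_of B (v (Suc k) \<omega> - v k \<omega>))\<^sup>2 / 2)) \<in> borel_measurable M"
    by measurable
  then show ?case
    by (rule measurable_cong[THEN iffD1, rotated]) (simp only: usfgm.H_Suc[OF path])
qed

lemma bounded_diff_square_integrable:
  assumes [measurable]: "p \<in> borel_measurable M" "q \<in> borel_measurable M"
    and dom: "\<And>\<omega>. \<omega> \<in> space M \<Longrightarrow> p \<omega> \<in> eff_dom \<psi>" "\<And>\<omega>. \<omega> \<in> space M \<Longrightarrow> q \<omega> \<in> eff_dom \<psi>"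
  shows "integrable M (\<lambda>\<omega>. (norm (p \<omega> - q \<omega>))\<^sup>2)"
proof -
  obtain K where K: "0 < K" "\<And>x. norm x \<le> K * norm_of B x"
    using norm_le_norm_of by blast
  have "norm (p \<omega> - q \<omega>) \<le> K * D" if "\<omega> \<in> space M" for \<omega>
    using order_trans[OF K(2) mult_left_mono[OF diam[OF dom]]] that K(1) by simp
  then have "norm ((norm (p \<omega> - q \<omega>))\<^sup>2) \<le> (K * D)\<^sup>2" if "\<omega> \<in> space M" for \<omega>
    using that by (simp add: power_mono)
  then show ?thesis
    by (intro M.integrable_const_bound[of _ "(K * D)\<^sup>2"] AE_I2) auto
qed

text \<open>The quantity \<open>noise\<close> along a random trajectory, with the errors written
  last to match \<open>oracle_error_orthogonal\<close>.\<close>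

definition path_noise :: "real^'n \<Rightarrow> nat \<Rightarrow> 'w \<Rightarrow> real" where
  "path_noise z k \<omega> = weight (Suc k) * ((z - v k \<omega>) \<bullet> error_y k \<omega>)
     - cum_weight (Suc k) * ((x (Suc k) \<omega> - y k \<omega>) \<bullet> error_x k \<omega>)"

text \<open>The test vectors z - v_k and x_{k+1} - y_k are bounded by the diameter and known before
  the sample they are paired with.\<close>

lemma path_noise_integral:
  assumes z: "z \<in> eff_dom \<psi>"
  shows "integrable M (path_noise z k)" "M.expectation (path_noise z k) = 0"
proof -
  let ?Gy = "hist_algebra k k k" and ?Gx = "hist_algebra (Suc k) (Suc k) k"
  have [measurable]: "v k \<in> borel_measurable ?Gy" "x (Suc k) \<in> borel_measurable ?Gx" "y k \<in> borel_measurable ?Gx"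
    using v_hist[OF history_y] x_hist[OF history_x] y_hist[OF history_x] by auto
  have W: "(\<lambda>\<omega>. z - v k \<omega>) \<in> borel_measurable ?Gy" "(\<lambda>\<omega>. x (Suc k) \<omega> - y k \<omega>) \<in> borel_measurable ?Gx"
    by measurable
  have sq: "integrable M (\<lambda>\<omega>. (norm (z - v k \<omega>))\<^sup>2)" "integrable M (\<lambda>\<omega>. (norm (x (Suc k) \<omega> - y k \<omega>))\<^sup>2)"
    using points_dom z by (auto intro!: bounded_diff_square_integrable)
  note orth = oracle_error_orthogonal[OF indep_y y_query[OF history_y order_refl] W(1) sq(1)]
    oracle_error_orthogonal[OF indep_x x_query[OF history_x order_refl] W(2) sq(2)]
  show "integrable M (path_noise z k)" "M.expectation (path_noise z k) = 0"
    unfolding path_noise_def [abs_def] error_y_def error_x_def using orth by simp_all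
qed

definition error_diff :: "nat \<Rightarrow> 'w \<Rightarrow> real" where
  "error_diff k \<omega> = dual_norm_of B (error_x k \<omega> - error_y k \<omega>)"

text \<open>Expanding the square leaves two variances and a cross term that pairs
  \<open>matrix_inv B *v error_y\<close>, known from the past, with the later error; its expectation
  is zero.\<close>

lemma error_diff_square:
  shows "integrable M (\<lambda>\<omega>. (error_diff k \<omega>)\<^sup>2)" "M.expectation (\<lambda>\<omega>. (error_diff k \<omega>)\<^sup>2) \<le> 2 * \<sigma>\<^sup>2"
proof -
  let ?Gx = "hist_algebra (Suc k) (Suc k) k"
  note sq_y = oracle_error_square[OF indep_y y_query[OF history_y order_refl], of k, folded error_y_def]
  note sq_x = oracle_error_square[OF indep_x x_query[OF history_x order_refl], of k, folded error_x_def]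
  have lin: "(\<lambda>s. matrix_inv B *v s) \<in> borel_measurable borel"
    by (intro borel_measurable_continuous_onI linear_continuous_on matrix_vector_mul_bounded_linear)
  have W: "(\<lambda>\<omega>. matrix_inv B *v error_y k \<omega>) \<in> borel_measurable ?Gx"
    using measurable_compose[OF error_y_hist lin] .
  have W_int: "integrable M (\<lambda>\<omega>. (norm (matrix_inv B *v error_y k \<omega>))\<^sup>2)"
  proof -
    obtain K where K: "0 < K" "\<And>x. norm (matrix_inv B *v x) \<le> norm x * K"
      using bounded_linear.pos_bounded[OF matrix_vector_mul_bounded_linear[of "matrix_inv B"]] by blast
    have bound: "(norm (matrix_inv B *v s))\<^sup>2 \<le> (norm s)\<^sup>2 * K\<^sup>2" for s
      using power_mono[OF K(2)[of s] norm_ge_zero, of 2] by (simp add: power_mult_distrib)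
    show ?thesis
    proof (rule Bochner_Integration.integrable_bound)
      show "integrable M (\<lambda>\<omega>. (norm (error_y k \<omega>))\<^sup>2 * K\<^sup>2)"
        using oracle_error_norm_square_integrable[OF indep_y y_query[OF history_y order_refl], of k]
        by (simp add: error_y_def)
      show "AE \<omega> in M. norm ((norm (matrix_inv B *v error_y k \<omega>))\<^sup>2) \<le> norm ((norm (error_y k \<omega>))\<^sup>2 * K\<^sup>2)"
        by (rule AE_I2) (simp add: bound)
      have "(\<lambda>\<omega>. matrix_inv B *v error_y k \<omega>) \<in> borel_measurable M"
        using measurable_compose[OF error_measurable(1) lin] .
      then show "(\<lambda>\<omega>. (norm (matrix_inv B *v error_y k \<omega>))\<^sup>2) \<in> borel_measurable M"
        by simp
    qed
  qed
  note orth = oracle_error_orthogonal[OF indep_x x_query[OF history_x order_refl] W W_int, folded error_x_def]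
  have eq: "(\<lambda>\<omega>. (error_diff k \<omega>)\<^sup>2) = (\<lambda>\<omega>. (dual_norm_of B (error_x k \<omega>))\<^sup>2 + (dual_norm_of B (error_y k \<omega>))\<^sup>2
      - 2 * ((matrix_inv B *v error_y k \<omega>) \<bullet> error_x k \<omega>))"
    by (simp add: error_diff_def dual_norm_of_diff_square)
  show "integrable M (\<lambda>\<omega>. (error_diff k \<omega>)\<^sup>2)" "M.expectation (\<lambda>\<omega>. (error_diff k \<omega>)\<^sup>2) \<le> 2 * \<sigma>\<^sup>2"
    unfolding eq using sq_x sq_y orth by simp_all
qed

lemma path_bounds:
  assumes \<omega>: "\<omega> \<in> space M"
  shows "0 \<le> H k \<omega>"
    and "z \<in> eff_dom \<psi> \<Longrightarrow> cum_weight k * (obj (x k \<omega>) - obj z) \<le> 2 * D\<^sup>2 * H k \<omega> + (\<Sum>i<k. path_noise z i \<omega>)"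
    and "0 \<le> \<nu> \<Longrightarrow> \<nu> \<le> 1 \<Longrightarrow> hoelder_const B \<psi> f \<nu> < \<infinity> \<Longrightarrow>
      H k \<omega> \<le> 8 * enn2real (hoelder_const B \<psi> f \<nu>) * D powr (\<nu> - 1) * real k powr (3 * (1 - \<nu>) / 2)
        + sqrt (2 * (\<Sum>i<k. (real (Suc i))\<^sup>2 * (error_diff i \<omega>)\<^sup>2)) / D"
proof -
  interpret usfgm B \<psi> f "mean_grad P g" D x0 "\<lambda>k. g (y k \<omega>) (\<xi>y k \<omega>)" "\<lambda>k. g (x k \<omega>) (\<xi>x k \<omega>)"
    "\<lambda>k. x k \<omega>" "\<lambda>k. v k \<omega>" "\<lambda>k. y k \<omega>" "\<lambda>k. H k \<omega>"
    using \<omega> by (rule path)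
  have "noise z i = path_noise z i \<omega>" for z i
    unfolding noise_def path_noise_def error_y_def error_x_def oracle_error_def by (simp add: inner_commute)
  moreover have "\<delta> i = error_diff i \<omega>" for i
    unfolding \<delta>_def error_diff_def error_y_def error_x_def oracle_error_def by simp
  ultimately show "0 \<le> H k \<omega>"
    and "z \<in> eff_dom \<psi> \<Longrightarrow> cum_weight k * (obj (x k \<omega>) - obj z) \<le> 2 * D\<^sup>2 * H k \<omega> + (\<Sum>i<k. path_noise z i \<omega>)"
    and "0 \<le> \<nu> \<Longrightarrow> \<nu> \<le> 1 \<Longrightarrow> hoelder_const B \<psi> f \<nu> < \<infinity> \<Longrightarrow>
      H k \<omega> \<le> 8 * enn2real (hoelder_const B \<psi> f \<nu>) * D powr (\<nu> - 1) * real k powr (3 * (1 - \<nu>) / 2)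
        + sqrt (2 * (\<Sum>i<k. (real (Suc i))\<^sup>2 * (error_diff i \<omega>)\<^sup>2)) / D"
    using H_nonneg gap_bound[of z k] H_le[of \<nu> k] by simp_all
qed

text \<open>Integrate the pathwise bound and move the expectation inside the square root; the factor
  4 is 2 from the pathwise bound times 2 from \<open>error_diff_square\<close>.\<close>

lemma H_expectation:
  assumes \<nu>: "0 \<le> \<nu>" "\<nu> \<le> 1" and fin: "hoelder_const B \<psi> f \<nu> < \<infinity>"
  shows "integrable M (H k)"
    and "M.expectation (H k)
      \<le> 8 * enn2real (hoelder_const B \<psi> f \<nu>) * D powr (\<nu> - 1) * real k powr (3 * (1 - \<nu>) / 2)
        + sqrt (4 * \<sigma>\<^sup>2 * (\<Sum>i<k. (real (Suc i))\<^sup>2)) / D"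
proof -
  define b where "b = 8 * enn2real (hoelder_const B \<psi> f \<nu>) * D powr (\<nu> - 1) * real k powr (3 * (1 - \<nu>) / 2)"
  define V where "V = (\<lambda>\<omega>. 2 * (\<Sum>i<k. (real (Suc i))\<^sup>2 * (error_diff i \<omega>)\<^sup>2))"
  have V: "integrable M V" "0 \<le> V \<omega>" for \<omega>
    using error_diff_square(1) by (auto simp: V_def intro!: sum_nonneg)
  note sqrt_V = M.expectation_sqrt_le[OF V]
  have bound_int: "integrable M (\<lambda>\<omega>. b + sqrt (V \<omega>) / D)"
    using sqrt_V(1) by simp
  have H_bound: "H k \<omega> \<le> b + sqrt (V \<omega>) / D" if "\<omega> \<in> space M" for \<omega>
    using path_bounds(3)[OF that \<nu> fin] by (simp add: b_def V_def)
  show int: "integrable M (H k)"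
  proof (rule Bochner_Integration.integrable_bound[OF bound_int])
    show "AE \<omega> in M. norm (H k \<omega>) \<le> norm (b + sqrt (V \<omega>) / D)"
    proof (rule AE_I2)
      fix \<omega> assume "\<omega> \<in> space M"
      then show "norm (H k \<omega>) \<le> norm (b + sqrt (V \<omega>) / D)"
        using path_bounds(1)[of \<omega> k] H_bound[of \<omega>] by simp
    qed
  qed simp
  have "M.expectation V = 2 * (\<Sum>i<k. (real (Suc i))\<^sup>2 * M.expectation (\<lambda>\<omega>. (error_diff i \<omega>)\<^sup>2))"
    unfolding V_def using error_diff_square(1) by simp
  also have "\<dots> \<le> 2 * (\<Sum>i<k. (real (Suc i))\<^sup>2 * (2 * \<sigma>\<^sup>2))"
    using error_diff_square(2) by (intro mult_left_mono sum_mono) auto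
  also have "\<dots> = 4 * \<sigma>\<^sup>2 * (\<Sum>i<k. (real (Suc i))\<^sup>2)"
    unfolding sum_distrib_right [symmetric] by simp
  finally have EV: "M.expectation V \<le> 4 * \<sigma>\<^sup>2 * (\<Sum>i<k. (real (Suc i))\<^sup>2)" .
  have "M.expectation (H k) \<le> M.expectation (\<lambda>\<omega>. b + sqrt (V \<omega>) / D)"
    using int bound_int H_bound by (rule integral_mono)
  also have "\<dots> = b + M.expectation (\<lambda>\<omega>. sqrt (V \<omega>)) / D"
    using sqrt_V(1) by (simp add: M.prob_space)
  also have "\<dots> \<le> b + sqrt (4 * \<sigma>\<^sup>2 * (\<Sum>i<k. (real (Suc i))\<^sup>2)) / D"
    using order_trans[OF sqrt_V(2) real_sqrt_le_mono[OF EV]] D_pos by (simp add: divide_right_mono)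
  finally show "M.expectation (H k)
      \<le> 8 * enn2real (hoelder_const B \<psi> f \<nu>) * D powr (\<nu> - 1) * real k powr (3 * (1 - \<nu>) / 2)
        + sqrt (4 * \<sigma>\<^sup>2 * (\<Sum>i<k. (real (Suc i))\<^sup>2)) / D"
    by (simp add: b_def)
qed

lemma obj_measurable [measurable]: "obj \<in> borel_measurable borel"
proof -
  have [measurable]: "f \<in> borel_measurable borel" "\<psi> \<in> borel_measurable borel"
    using f_closed_convex psi by (auto intro: closed_convex_fun_borel)
  show ?thesis
    unfolding obj_def [abs_def] by measurable
qed

text \<open>The noise sum integrates to zero. The pathwise gap bound from above and
  \<open>obj_bounded_below\<close> from below give integrability of the objective.\<close>

lemma gap_expectation:
  assumes k: "1 \<le> k" and H_int: "integrable M (H k)" and z: "z \<in> eff_dom \<psi>"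
  shows "integrable M (\<lambda>\<omega>. obj (x k \<omega>))"
    and "cum_weight k * (M.expectation (\<lambda>\<omega>. obj (x k \<omega>)) - obj z) \<le> 2 * D\<^sup>2 * M.expectation (H k)"
proof -
  have A: "0 < cum_weight k"
    using k cum_weight_Suc_pos[of "k - 1"] by simp
  define U where "U = (\<lambda>\<omega>. 2 * D\<^sup>2 * H k \<omega> + (\<Sum>i<k. path_noise z i \<omega>))"
  have U: "integrable M U" "M.expectation U = 2 * D\<^sup>2 * M.expectation (H k)"
    unfolding U_def using H_int path_noise_integral[OF z] by simp_all
  have le_U: "cum_weight k * (obj (x k \<omega>) - obj z) \<le> U \<omega>" if "\<omega> \<in> space M" for \<omega>
    using path_bounds(2)[OF that z] by (simp add: U_def)
  then have upper: "obj (x k \<omega>) \<le> obj z + U \<omega> / cum_weight k" if "\<omega> \<in> space M" for \<omega>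
    using that A by (simp add: field_simps)
  obtain m where m: "\<And>w. w \<in> eff_dom \<psi> \<Longrightarrow> m \<le> obj w"
    using obj_bounded_below by blast
  show int: "integrable M (\<lambda>\<omega>. obj (x k \<omega>))"
  proof (rule Bochner_Integration.integrable_bound)
    show "integrable M (\<lambda>\<omega>. \<bar>m\<bar> + \<bar>obj z + U \<omega> / cum_weight k\<bar>)"
      using U(1) by simp
    show "AE \<omega> in M. norm (obj (x k \<omega>)) \<le> norm (\<bar>m\<bar> + \<bar>obj z + U \<omega> / cum_weight k\<bar>)"
    proof (rule AE_I2)
      fix \<omega> assume \<omega>: "\<omega> \<in> space M"
      show "norm (obj (x k \<omega>)) \<le> norm (\<bar>m\<bar> + \<bar>obj z + U \<omega> / cum_weight k\<bar>)"
        using upper[OF \<omega>] m[OF points_dom(2)[OF \<omega>, of k]] unfolding real_norm_def by linarith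
    qed
  qed simp
  have "M.expectation (\<lambda>\<omega>. cum_weight k * (obj (x k \<omega>) - obj z)) \<le> M.expectation U"
    using int U(1) le_U by (intro integral_mono) auto
  then show "cum_weight k * (M.expectation (\<lambda>\<omega>. obj (x k \<omega>)) - obj z) \<le> 2 * D\<^sup>2 * M.expectation (H k)"
    using int U(2) by (simp add: M.prob_space)
qed

end

subsection \<open>Rate and complexity\<close>

lemma sum_Suc_squares: "(\<Sum>i<k. (real (Suc i))\<^sup>2) = real k * (real k + 1) * (2 * real k + 1) / 6"
  by (induction k) (auto simp: power2_eq_square field_simps)

text \<open>Uses 3 (1 - \<nu>) / 2 = 2 - (1 + 3 \<nu>) / 2 and 16 k^2 \<le> 16 k (k + 1) = 32
  A_k.\<close>

lemma deterministic_rate: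
  fixes L D \<nu> :: real
  assumes k: "1 \<le> k" and L: "0 \<le> L" and D: "0 < D"
  shows "2 * D\<^sup>2 * (8 * L * D powr (\<nu> - 1) * real k powr (3 * (1 - \<nu>) / 2))
    \<le> cum_weight k * (32 * L * D powr (1 + \<nu>) / real k powr ((1 + 3 * \<nu>) / 2))"
proof -
  define c where "c = L * D powr (1 + \<nu>) / real k powr ((1 + 3 * \<nu>) / 2)"
  have c: "0 \<le> c"
    using L by (simp add: c_def)
  have D_eq: "D powr (1 + \<nu>) = D\<^sup>2 * D powr (\<nu> - 1)"
    using D by (simp add: powr_add powr_diff power2_eq_square)
  have "real k powr (3 * (1 - \<nu>) / 2) = real k powr (2 - (1 + 3 * \<nu>) / 2)"
    by (simp add: field_simps)
  also have "\<dots> = (real k)\<^sup>2 / real k powr ((1 + 3 * \<nu>) / 2)"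
    using k by (simp add: powr_diff)
  finally have k_eq: "real k powr (3 * (1 - \<nu>) / 2) = (real k)\<^sup>2 / real k powr ((1 + 3 * \<nu>) / 2)" .
  have "2 * D\<^sup>2 * (8 * L * D powr (\<nu> - 1) * real k powr (3 * (1 - \<nu>) / 2)) = 16 * (real k)\<^sup>2 * c"
    unfolding k_eq c_def D_eq by simp
  also have "\<dots> \<le> 32 * cum_weight k * c"
    using c by (intro mult_right_mono) (auto simp: cum_weight_eq power2_eq_square algebra_simps)
  also have "\<dots> = cum_weight k * (32 * L * D powr (1 + \<nu>) / real k powr ((1 + 3 * \<nu>) / 2))"
    by (simp add: c_def)
  finally show ?thesis .
qed

text \<open>Bounding 2 k + 1 by 2 k + 2 makes the sum of squares at most k (k + 1)^2 / 3, whose root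
  cancels against A_k up to the factor 1 / sqrt (3 k).\<close>

lemma noise_rate:
  fixes \<sigma> D :: real
  assumes k: "1 \<le> k" and \<sigma>: "0 \<le> \<sigma>" and D: "0 < D"
  shows "2 * D\<^sup>2 * (sqrt (4 * \<sigma>\<^sup>2 * (\<Sum>i<k. (real (Suc i))\<^sup>2)) / D) \<le> cum_weight k * (8 * \<sigma> * D / sqrt (3 * real k))"
proof -
  define t where "t = 2 * \<sigma> * (real k + 1) * real k / sqrt (3 * real k)"
  have t: "0 \<le> t"
    using \<sigma> by (simp add: t_def)
  have "4 * \<sigma>\<^sup>2 * (\<Sum>i<k. (real (Suc i))\<^sup>2) \<le> 4 * \<sigma>\<^sup>2 * (real k * (real k + 1)\<^sup>2 / 3)"
    unfolding sum_Suc_squares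
    by (intro mult_left_mono) (auto simp: power2_eq_square field_simps)
  also have "\<dots> = t\<^sup>2"
    using k by (simp add: t_def power_divide power_mult_distrib) (simp add: power2_eq_square field_simps)
  finally have "sqrt (4 * \<sigma>\<^sup>2 * (\<Sum>i<k. (real (Suc i))\<^sup>2)) \<le> t"
    using t real_sqrt_le_mono by fastforce
  then have "2 * D\<^sup>2 * (sqrt (4 * \<sigma>\<^sup>2 * (\<Sum>i<k. (real (Suc i))\<^sup>2)) / D) \<le> 2 * D\<^sup>2 * (t / D)"
    using D by (intro mult_left_mono divide_right_mono) auto
  also have "\<dots> = 2 * D * t"
    using D by (simp add: power2_eq_square)
  also have "\<dots> = cum_weight k * (8 * \<sigma> * D / sqrt (3 * real k))"
    unfolding t_def cum_weight_eq by simp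
  finally show ?thesis .
qed

text \<open>As 4096 = 64^2 and the exponent is at least 1/2, one constant serves all \<nu>. The
  factor 64 is twice the 32 of the rate, since the Hoelder part may use only \<epsilon> / 2.\<close>

lemma powr_rate_le:
  fixes u \<nu> k :: real
  assumes u: "0 \<le> u" "u powr (2 / (1 + 3 * \<nu>)) < k / 4096" and \<nu>: "0 \<le> \<nu>" and k: "0 < k"
  shows "64 * u \<le> k powr ((1 + 3 * \<nu>) / 2)"
proof -
  have "u = (u powr (2 / (1 + 3 * \<nu>))) powr ((1 + 3 * \<nu>) / 2)"
    using u(1) \<nu> by (simp add: powr_powr)
  also have "\<dots> \<le> (k / 4096) powr ((1 + 3 * \<nu>) / 2)"
    using u(2) \<nu> by (intro powr_mono2) auto
  also have "\<dots> = k powr ((1 + 3 * \<nu>) / 2) / 4096 powr ((1 + 3 * \<nu>) / 2)"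
    using k by (simp add: powr_divide)
  also have "\<dots> \<le> k powr ((1 + 3 * \<nu>) / 2) / 64"
  proof -
    have "(4096::real) powr (1 / 2) \<le> 4096 powr ((1 + 3 * \<nu>) / 2)"
      using \<nu> by (intro powr_mono) auto
    moreover have "(4096::real) powr (1 / 2) = 64"
      by (simp add: powr_half_sqrt real_sqrt_unique)
    ultimately show ?thesis
      by (intro divide_left_mono) auto
  qed
  finally show ?thesis
    by simp
qed

text \<open>For finite c, subtract c, pass to the infimum and add c again. A negative X is truncated
  to 0 by \<open>e2ennreal\<close>, which is harmless as the right side is nonnegative.\<close>

lemma le_enn2ereal_INF_add:
  assumes le: "\<And>i. i \<in> I \<Longrightarrow> X \<le> enn2ereal (h i + c)"
  shows "X \<le> enn2ereal ((INF i\<in>I. h i) + c)"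
proof -
  have le': "e2ennreal X \<le> h i + c" if "i \<in> I" for i
    using e2ennreal_mono[OF le[OF that]] by simp
  have "e2ennreal X \<le> (INF i\<in>I. h i) + c"
  proof (cases "c = top")
    case False
    have "e2ennreal X - c \<le> h i" if "i \<in> I" for i
      using le'[OF that] False by (simp add: ennreal_minus_le_iff add.commute)
    then have "e2ennreal X - c \<le> (INF i\<in>I. h i)"
      by (rule INF_greatest)
    then show ?thesis
      using False by (simp add: ennreal_minus_le_iff add.commute)
  qed simp
  then have "enn2ereal (e2ennreal X) \<le> enn2ereal ((INF i\<in>I. h i) + c)"
    by (simp add: less_eq_ennreal.rep_eq)
  moreover have "X \<le> enn2ereal (e2ennreal X)"
    by (cases "0 \<le> X") (auto simp: enn2ereal_e2ennreal intro: order_trans[OF _ enn2ereal_nonneg])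
  ultimately show ?thesis
    by (rule order_trans [rotated])
qed

section \<open>Rate in expectation and oracle complexity\<close>

context stochastic_usfgm
begin

abbreviation hoelder_rate :: "nat \<Rightarrow> real \<Rightarrow> real" where
  "hoelder_rate k \<nu> \<equiv>
    32 * enn2real (hoelder_const B \<psi> f \<nu>) * D powr (1 + \<nu>) / real k powr ((1 + 3 * \<nu>) / 2)"

lemma expected_gap_le:
  assumes \<sigma>: "0 \<le> \<sigma>" and k: "1 \<le> k" and \<nu>: "\<nu> \<in> {0..1}" and fin: "hoelder_const B \<psi> f \<nu> < \<infinity>"
    and z: "z \<in> eff_dom \<psi>"
  shows "M.expectation (\<lambda>\<omega>. obj (x k \<omega>)) - obj z \<le> hoelder_rate k \<nu> + 8 * \<sigma> * D / sqrt (3 * real k)"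
proof -
  have \<nu>': "0 \<le> \<nu>" "\<nu> \<le> 1"
    using \<nu> by auto
  have A: "0 < cum_weight k"
    using k cum_weight_Suc_pos[of "k - 1"] by simp
  have "cum_weight k * (M.expectation (\<lambda>\<omega>. obj (x k \<omega>)) - obj z) \<le> 2 * D\<^sup>2 * M.expectation (H k)"
    using k H_expectation(1)[OF \<nu>' fin] z by (rule gap_expectation(2))
  also have "\<dots> \<le> 2 * D\<^sup>2 * (8 * enn2real (hoelder_const B \<psi> f \<nu>) * D powr (\<nu> - 1) * real k powr (3 * (1 - \<nu>) / 2)
      + sqrt (4 * \<sigma>\<^sup>2 * (\<Sum>i<k. (real (Suc i))\<^sup>2)) / D)"
    using H_expectation(2)[OF \<nu>' fin] by (intro mult_left_mono) auto
  also have "\<dots> \<le> cum_weight k * hoelder_rate k \<nu> + cum_weight k * (8 * \<sigma> * D / sqrt (3 * real k))"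
    unfolding distrib_left by (intro add_mono deterministic_rate noise_rate k \<sigma> D_pos enn2real_nonneg)
  finally show ?thesis
    using A unfolding distrib_left [symmetric] by simp
qed

text \<open>The bound holds against every feasible z with the same right side, so it passes to the
  infimum without choosing a minimiser.\<close>

lemma expected_gap_INF_le:
  assumes "0 \<le> \<sigma>" "1 \<le> k" "\<nu> \<in> {0..1}" "hoelder_const B \<psi> f \<nu> < \<infinity>"
  shows "ereal (M.expectation (\<lambda>\<omega>. obj (x k \<omega>))) - (INF z\<in>eff_dom \<psi>. f z + \<psi> z)
    \<le> ereal (hoelder_rate k \<nu> + 8 * \<sigma> * D / sqrt (3 * real k))"
proof -
  define E b where "E = M.expectation (\<lambda>\<omega>. obj (x k \<omega>))"
    and "b = hoelder_rate k \<nu> + 8 * \<sigma> * D / sqrt (3 * real k)"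
  have "ereal (E - b) \<le> f z + \<psi> z" if "z \<in> eff_dom \<psi>" for z
    using expected_gap_le[OF assms that] unfolding objective_eq_obj[OF that] E_def b_def by simp
  then have "ereal (E - b) \<le> (INF z\<in>eff_dom \<psi>. f z + \<psi> z)"
    by (rule INF_greatest)
  then show ?thesis
    unfolding E_def [symmetric] b_def [symmetric]
    by (cases "INF z\<in>eff_dom \<psi>. f z + \<psi> z") auto
qed

lemma hoelder_term_eq:
  assumes fin: "hoelder_const B \<psi> f \<nu> < \<infinity>" and t: "0 < t"
  shows "hoelder_const B \<psi> f \<nu> * ennreal (D powr (1 + \<nu>)) / ennreal t
    = ennreal (enn2real (hoelder_const B \<psi> f \<nu>) * D powr (1 + \<nu>) / t)"
proof -
  have "hoelder_const B \<psi> f \<nu> = ennreal (enn2real (hoelder_const B \<psi> f \<nu>))"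
    using fin by (simp add: ennreal_enn2real)
  then show ?thesis
    using t by (metis divide_ennreal ennreal_mult enn2real_nonneg mult_nonneg_nonneg powr_ge_zero)
qed

text \<open>Positivity of \<open>D\<close> keeps the product away from the convention \<infinity> *
  0 = 0, so such \<nu> have infinite terms in the infima.\<close>

lemma hoelder_term_top:
  assumes "\<not> hoelder_const B \<psi> f \<nu> < \<infinity>" and t: "0 < t"
  shows "hoelder_const B \<psi> f \<nu> * ennreal (D powr (1 + \<nu>)) / ennreal t = \<infinity>"
proof -
  have "hoelder_const B \<psi> f \<nu> = \<infinity>"
    using assms(1) by (metis infinity_ennreal_def top.not_eq_extremum)
  then show ?thesis
    using D_pos t by (simp add: ennreal_top_mult ennreal_top_divide)
qed

lemma convergence_rate:
  assumes \<sigma>: "0 \<le> \<sigma>" and k: "1 \<le> k"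
  shows "ereal (M.expectation (\<lambda>\<omega>. obj (x k \<omega>))) - (INF z\<in>eff_dom \<psi>. f z + \<psi> z)
    \<le> enn2ereal ((INF \<nu>\<in>{0..1}. 32 * hoelder_const B \<psi> f \<nu> * ennreal (D powr (1 + \<nu>))
          / ennreal (real k powr ((1 + 3 * \<nu>) / 2))) + ennreal (8 * \<sigma> * D / sqrt (3 * real k)))"
proof (rule le_enn2ereal_INF_add)
  fix \<nu> :: real assume \<nu>: "\<nu> \<in> {0..1}"
  define t where "t = real k powr ((1 + 3 * \<nu>) / 2)"
  have t: "0 < t"
    using k by (simp add: t_def)
  have assoc: "32 * hoelder_const B \<psi> f \<nu> * ennreal (D powr (1 + \<nu>)) / ennreal t
      = 32 * (hoelder_const B \<psi> f \<nu> * ennreal (D powr (1 + \<nu>)) / ennreal t)"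
    by (simp add: divide_ennreal_def mult.assoc)
  have noise: "0 \<le> 8 * \<sigma> * D / sqrt (3 * real k)"
    using \<sigma> D_pos by simp
  show "ereal (M.expectation (\<lambda>\<omega>. obj (x k \<omega>))) - (INF z\<in>eff_dom \<psi>. f z + \<psi> z)
      \<le> enn2ereal (32 * hoelder_const B \<psi> f \<nu> * ennreal (D powr (1 + \<nu>)) / ennreal (real k powr ((1 + 3 * \<nu>) / 2))
        + ennreal (8 * \<sigma> * D / sqrt (3 * real k)))"
  proof (cases "hoelder_const B \<psi> f \<nu> < \<infinity>")
    case True
    have "32 * hoelder_const B \<psi> f \<nu> * ennreal (D powr (1 + \<nu>)) / ennreal t = ennreal (hoelder_rate k \<nu>)"
      unfolding assoc hoelder_term_eq[OF True t]
      by (subst ennreal_numeral [symmetric], subst ennreal_mult [symmetric]) (simp_all add: t_def)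
    then have "32 * hoelder_const B \<psi> f \<nu> * ennreal (D powr (1 + \<nu>)) / ennreal t + ennreal (8 * \<sigma> * D / sqrt (3 * real k))
        = ennreal (hoelder_rate k \<nu> + 8 * \<sigma> * D / sqrt (3 * real k))"
      using noise by (simp add: ennreal_plus)
    moreover have "0 \<le> hoelder_rate k \<nu> + 8 * \<sigma> * D / sqrt (3 * real k)"
      using noise by (intro add_nonneg_nonneg) auto
    ultimately show ?thesis
      using expected_gap_INF_le[OF \<sigma> k \<nu> True] by (simp only: t_def enn2ereal_ennreal)
  next
    case False
    show ?thesis
      unfolding t_def [symmetric] assoc hoelder_term_top[OF False t] by (simp add: ennreal_mult_top)
  qed
qed

text \<open>Noise and Hoelder part each receive \<epsilon> / 2. With 2 k calls, the hypothesis makes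
  the bracket at most k / 5000, which is enough for both.\<close>

lemma oracle_complexity:
  assumes \<sigma>: "0 \<le> \<sigma>" and k: "1 \<le> k" and \<epsilon>: "0 < \<epsilon>"
    and calls: "10000 * ((INF \<nu>\<in>{0..1}. ennreal_powr (hoelder_const B \<psi> f \<nu> * ennreal (D powr (1 + \<nu>)) / ennreal \<epsilon>)
          (2 / (1 + 3 * \<nu>))) + ennreal (\<sigma>\<^sup>2 * D\<^sup>2 / \<epsilon>\<^sup>2)) \<le> of_nat (usfgm_oracle_calls k)"
  shows "ereal (M.expectation (\<lambda>\<omega>. obj (x k \<omega>))) - (INF z\<in>eff_dom \<psi>. f z + \<psi> z) \<le> ereal \<epsilon>"
proof -
  define T where "T = (\<lambda>\<nu>. ennreal_powr (hoelder_const B \<psi> f \<nu> * ennreal (D powr (1 + \<nu>)) / ennreal \<epsilon>) (2 / (1 + 3 * \<nu>)))"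
  define s where "s = \<sigma>\<^sup>2 * D\<^sup>2 / \<epsilon>\<^sup>2"
  have s: "0 \<le> s"
    by (simp add: s_def)
  have calls': "10000 * ((INF \<nu>\<in>{0..1}. T \<nu>) + ennreal s) \<le> ennreal (2 * real k)"
    using calls unfolding T_def s_def usfgm_oracle_calls_def ennreal_of_nat_eq_real_of_nat by simp
  have noise: "8 * \<sigma> * D / sqrt (3 * real k) \<le> \<epsilon> / 2"
  proof -
    have "10000 * ennreal s \<le> 10000 * ((INF \<nu>\<in>{0..1}. T \<nu>) + ennreal s)"
      by (intro mult_left_mono) auto
    then have "10000 * ennreal s \<le> ennreal (2 * real k)"
      using calls' by (rule order_trans)
    then have "ennreal (10000 * s) \<le> ennreal (2 * real k)"
      using s by (simp add: ennreal_mult)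
    then have "10000 * s \<le> 2 * real k"
      by (simp add: ennreal_le_iff)
    then have "10000 * (\<sigma>\<^sup>2 * D\<^sup>2) \<le> 2 * real k * \<epsilon>\<^sup>2"
      using \<epsilon> by (simp add: s_def field_simps)
    moreover have "0 \<le> real k * \<epsilon>\<^sup>2"
      by simp
    ultimately have "64 * (\<sigma>\<^sup>2 * D\<^sup>2) \<le> 3 / 4 * (real k * \<epsilon>\<^sup>2)"
      by linarith
    then have "(8 * \<sigma> * D)\<^sup>2 \<le> (\<epsilon> / 2)\<^sup>2 * (3 * real k)"
      by (simp add: power_mult_distrib power_divide mult_ac)
    also have "\<dots> = (\<epsilon> / 2 * sqrt (3 * real k))\<^sup>2"
      by (simp add: power_mult_distrib power_divide)
    finally have "8 * \<sigma> * D \<le> \<epsilon> / 2 * sqrt (3 * real k)"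
      by (rule power2_le_imp_le) (use \<epsilon> in simp)
    then show ?thesis
      using k by (subst pos_divide_le_eq) simp_all
  qed
  \<comment> \<open>As k is positive, k / 5000 is strictly below k / 4096; strictness yields a
    suitable \<nu> without attainment of the infimum.\<close>
  have "(INF \<nu>\<in>{0..1}. T \<nu>) < ennreal (real k / 4096)"
  proof (rule ccontr)
    assume "\<not> ?thesis"
    then have "ennreal (real k / 4096) \<le> (INF \<nu>\<in>{0..1}. T \<nu>) + ennreal s"
      by (intro add_increasing2) (simp_all add: not_less)
    then have "10000 * ennreal (real k / 4096) \<le> 10000 * ((INF \<nu>\<in>{0..1}. T \<nu>) + ennreal s)"
      by (rule mult_left_mono) simp
    then have "10000 * ennreal (real k / 4096) \<le> ennreal (2 * real k)"
      using calls' by (rule order_trans)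
    moreover have "10000 * ennreal (real k / 4096) = ennreal (10000 * (real k / 4096))"
      by (subst ennreal_numeral [symmetric], subst ennreal_mult [symmetric]) simp_all
    ultimately show False
      using k by (simp add: ennreal_le_iff)
  qed
  then obtain \<nu> where \<nu>: "\<nu> \<in> {0..1}" and T: "T \<nu> < ennreal (real k / 4096)"
    unfolding INF_less_iff by blast
  have fin: "hoelder_const B \<psi> f \<nu> < \<infinity>"
  proof (rule ccontr)
    assume top: "\<not> ?thesis"
    have "T \<nu> = \<infinity>"
      unfolding T_def hoelder_term_top[OF top \<epsilon>] by (simp add: ennreal_powr_def)
    with T show False
      by simp
  qed
  define u where "u = enn2real (hoelder_const B \<psi> f \<nu>) * D powr (1 + \<nu>) / \<epsilon>"
  have u: "0 \<le> u"
    using \<epsilon> by (simp add: u_def)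
  have "T \<nu> = ennreal (u powr (2 / (1 + 3 * \<nu>)))"
    unfolding T_def hoelder_term_eq[OF fin \<epsilon>] ennreal_powr_def u_def [symmetric] using u by simp
  then have "u powr (2 / (1 + 3 * \<nu>)) < real k / 4096"
    using T by (simp add: ennreal_less_iff)
  then have "64 * u \<le> real k powr ((1 + 3 * \<nu>) / 2)"
    using u \<nu> k by (intro powr_rate_le) auto
  then have "hoelder_rate k \<nu> \<le> \<epsilon> / 2"
    using \<epsilon> k by (simp add: u_def field_simps)
  then have "hoelder_rate k \<nu> + 8 * \<sigma> * D / sqrt (3 * real k) \<le> \<epsilon>"
    using noise by linarith
  then show ?thesis
    using order_trans[OF expected_gap_INF_le[OF \<sigma> k \<nu> fin]] by simp
qed

end

theorem theorem5p1:
  fixes B :: "real^'n^'n"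
    and \<psi> f :: "real^'n \<Rightarrow> ereal"
    and P :: "'e measure" and g :: "real^'n \<Rightarrow> 'e \<Rightarrow> real^'n"
    and M :: "'w measure" and \<xi>y \<xi>x :: "nat \<Rightarrow> 'w \<Rightarrow> 'e"
    and x v y :: "nat \<Rightarrow> 'w \<Rightarrow> real^'n" and H :: "nat \<Rightarrow> 'w \<Rightarrow> real"
    and x0 :: "real^'n" and D \<sigma> :: real
    and F :: "real^'n \<Rightarrow> ereal" and Fstar :: ereal
  assumes B: "sym_posdef B"
    and psi: "closed_convex_fun \<psi>" "eff_dom \<psi> \<noteq> {}"
    and f: "closed_convex_fun f"
      "\<exists>U. open U \<and> eff_dom \<psi> \<subseteq> U \<and> (\<forall>z\<in>U. \<bar>f z\<bar> \<noteq> \<infinity> \<and> subdifferential f z \<noteq> {})"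
    and F: "F = (\<lambda>z. f z + \<psi> z)"
    and Fstar: "Fstar = (INF z\<in>eff_dom \<psi>. F z)"
    and D: "D > 0" "\<And>z w. z \<in> eff_dom \<psi> \<Longrightarrow> w \<in> eff_dom \<psi> \<Longrightarrow> norm_of B (z - w) \<le> D"
    and hoelder: "\<exists>\<nu>\<in>{0..1}. hoelder_const B \<psi> f \<nu> < \<infinity>"
    and unbiased: "unbiased_oracle \<psi> f P g"
    and variance: "\<sigma> \<ge> 0" "ennreal (\<sigma>\<^sup>2) = oracle_variance B \<psi> P g"
    and M: "prob_space M"
    and fresh: "fresh_copies M P v \<xi>y \<xi>x"
    and run: "\<And>\<omega>. \<omega> \<in> space M \<Longrightarrow>
      usfgm_run B \<psi> D x0 (\<lambda>k. g (y k \<omega>) (\<xi>y k \<omega>)) (\<lambda>k. g (x k \<omega>) (\<xi>x k \<omega>))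
        (\<lambda>k. x k \<omega>) (\<lambda>k. v k \<omega>) (\<lambda>k. y k \<omega>) (\<lambda>k. H k \<omega>)"
  shows "(\<forall>k\<ge>1. integrable M (\<lambda>\<omega>. real_of_ereal (F (x k \<omega>))) \<and>
            ereal (\<integral>\<omega>. real_of_ereal (F (x k \<omega>)) \<partial>M) - Fstar
              \<le> enn2ereal ((INF \<nu>\<in>{0..1}. 32 * hoelder_const B \<psi> f \<nu> * ennreal (D powr (1 + \<nu>))
                                            / ennreal (real k powr ((1 + 3 * \<nu>) / 2)))
                           + ennreal (8 * \<sigma> * D / sqrt (3 * real k)))) \<and>
         (\<forall>\<epsilon>>0. \<forall>k\<ge>1.
            10000 * ((INF \<nu>\<in>{0..1}. ennreal_powr (hoelder_const B \<psi> f \<nu> * ennreal (D powr (1 + \<nu>)) / ennreal \<epsilon>)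
                                      (2 / (1 + 3 * \<nu>)))
                     + ennreal (\<sigma>\<^sup>2 * D\<^sup>2 / \<epsilon>\<^sup>2))
              \<le> of_nat (usfgm_oracle_calls k) \<longrightarrow>
            ereal (\<integral>\<omega>. real_of_ereal (F (x k \<omega>)) \<partial>M) - Fstar \<le> ereal \<epsilon>)"
proof -
  obtain z where z: "z \<in> eff_dom \<psi>"
    using psi(2) by blast
  note \<sigma> = variance(1)
  interpret stochastic_usfgm B \<psi> f P g \<sigma> M D \<xi>y \<xi>x x v y H x0
  proof (intro stochastic_usfgm.intro stochastic_oracle.intro spd_matrix.intro stochastic_oracle_axioms.intro
      composite_problem.intro composite_problem_axioms.intro stochastic_usfgm_axioms.intro)
    \<comment> \<open>Unbiasedness is exactly what makes the mean answer an admissible subgradient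
      selection.\<close>
    show "mean_grad P g z \<in> subdifferential f z" if "z \<in> eff_dom \<psi>" for z
      using unbiased that by (simp add: unbiased_oracle_def mean_grad_def)
  qed (fact B psi f D unbiased variance M fresh run)+
  have F_obj: "real_of_ereal (F (x k \<omega>)) = obj (x k \<omega>)" if "\<omega> \<in> space M" for k \<omega>
    using objective_eq_obj[OF points_dom(2)[OF that]] by (simp add: F)
  have E_eq: "(\<integral>\<omega>. real_of_ereal (F (x k \<omega>)) \<partial>M) = M.expectation (\<lambda>\<omega>. obj (x k \<omega>))" for k
    using F_obj by (intro Bochner_Integration.integral_cong) auto
  \<comment> \<open>The assumed finite Hoelder constant serves integrability; the rate and the
    complexity bound range over all \<nu> by themselves.\<close>
  obtain \<nu> where \<nu>: "0 \<le> \<nu>" "\<nu> \<le> 1" and fin: "hoelder_const B \<psi> f \<nu> < \<infinity>"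
    using hoelder by auto
  have "integrable M (\<lambda>\<omega>. real_of_ereal (F (x k \<omega>)))" if "1 \<le> k" for k
    using gap_expectation(1)[OF that H_expectation(1)[OF \<nu> fin] z] F_obj
    by (subst Bochner_Integration.integrable_cong) auto
  moreover have "Fstar = (INF z\<in>eff_dom \<psi>. f z + \<psi> z)"
    by (simp add: Fstar F)
  ultimately show ?thesis
    unfolding E_eq using convergence_rate[OF \<sigma>] oracle_complexity[OF \<sigma>] by blast
qed

end
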